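(* Determining whether an asynchronous program with cancel $\mathfrak P$ has a fair infinite run is undecidable, and determining whether $\mathfrak P$ has a run that fairly starves some handler $a\in\Sigma$ is undecidable.
   Context: Multisets over a finite set $\Sigma$ are maps $\Sigma\to\mathbb{N}$; $\oplus$ is pointwise sum and $[\sigma]$ the multiset with one copy of $\sigma$. For a word $w$ and letter $b$, $\mathsf{Parikh}(w)(b)$ is the number of occurrences of $b$ in $w$. Let $\Sigma$ be a finite alphabet of handler names, $\overline\Sigma=\{\bar\sigma\mid\sigma\in\Sigma\}$ a disjoint copy, $\Sigma_i$ an alphabet of internal actions disjoint from both, and $\Gamma=\Sigma_i\cup\Sigma\cup\overline\Sigma$. An asynchronous program with cancel is $\mathfrak P=(D,\Sigma\cup\overline\Sigma,\Sigma_i,G,R,d_0,\mathbf m_0)$ with $D$ a finite set of global states, $G=(\mathcal X,\Gamma,\mathcal P)$ a context-free grammar (productions in $\mathcal X\times(\mathcal X^2\cup\Gamma\cup\{\varepsilon\})$) with a nonterminal $X_\sigma$ for each $\sigma\in\Sigma$, $R=(D,\Gamma,\delta)$ a regular grammar with nonterminal set $D$ (productions $d\to a\,d'$, $a\in\Gamma$, or $d\to\varepsilon$), $\mathbf m_0$ a multiset over $\Sigma$, $d_0\in D$. There is a transition $(d,\mathbf m\oplus[\sigma])\xrightarrow{\sigma}(d',\mathbf m')$ (and $\sigma$ is dispatched in it) iff there is $w\in\Gamma^*$ with $d\Rightarrow_R^* w\,d'$, $X_\sigma\Rightarrow_G^* w$, and for every $b\in\Sigma$ either (i) $w=w_1\bar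 b w_2$ with $w_2\in(\Gamma\setminus\{\bar b\})^*$ and $\mathbf m'(b)=\mathsf{Parikh}(w_2)(b)$, or (ii) $w\in(\Gamma\setminus\{\bar b\})^*$ and $\mathbf m'(b)=\mathbf m(b)+\mathsf{Parikh}(w)(b)$. A handler $\sigma$ is pending at $(d,\mathbf m)$ if $\mathbf m(\sigma)>0$. An infinite run $c_0\xrightarrow{\sigma_0}c_1\xrightarrow{\sigma_1}\cdots$ starts at $c_0=(d_0,\mathbf m_0)$; it is fair if for every $\sigma\in\Sigma$, if $\sigma$ is dispatched only finitely often then there are infinitely many $j$ with $\sigma$ not pending at $c_j$. A run fairly starves $a\in\Sigma$ if it is a fair infinite run and there is $J\ge0$ such that for all $j\ge J$: $c_j.\mathbf m(a)\ge1$, and if $c_j\xrightarrow{a}c_{j+1}$ then $c_j.\mathbf m(a)\ge2$. *)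

theory Defs
  imports Complex_Main "HOL-Library.Multiset" "HOL-Library.Nat_Bijection"
begin

section \<open>Grammars\<close>

datatype ('n, 't) sym = N 'n | T 't

type_synonym ('n, 't) grammar = "('n \<times> ('n, 't) sym list) set"

definition derives1 :: "('n, 't) grammar \<Rightarrow> ('n, 't) sym list \<Rightarrow> ('n, 't) sym list \<Rightarrow> bool" where
  "derives1 P u v \<longleftrightarrow>
     (\<exists>x A \<alpha> y. (A, \<alpha>) \<in> P \<and> u = x @ [N A] @ y \<and> v = x @ \<alpha> @ y)"

abbreviation derives :: "('n, 't) grammar \<Rightarrow> ('n, 't) sym list \<Rightarrow> ('n, 't) sym list \<Rightarrow> bool" where
  "derives P \<equiv> (derives1 P)\<^sup>*\<^sup>*"


section \<open>Asynchronous programs with cancel\<close>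

text \<open>
  The disjoint union of the internal actions, the handler names \<open>\<sigma>\<close> (here \<open>Post \<sigma>\<close>)
  and their barred copies (here \<open>Cancel \<sigma>\<close>).
\<close>

datatype ('s, 'i) letter = Internal 'i | Post 's | Cancel 's

text \<open>
  \<open>nonterm_of\<close> is the family \<open>(X\<^sub>\<sigma>)\<close> of nonterminals, a partial map whose domain is the set of
  handler names.  The set \<open>states\<close> is also the set of nonterminals of the regular grammar \<open>moves\<close>.
\<close>

record ('d, 's, 'i, 'x) apc =
  states :: "'d set"
  handlers :: "'s set"
  internals :: "'i set"
  nonterms :: "'x set"
  prods :: "('x, ('s, 'i) letter) grammar"
  nonterm_of :: "'s \<rightharpoonup> 'x"
  moves :: "('d, ('s, 'i) letter) grammar"
  init_state :: "'d"
  init_tasks :: "'s multiset"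

definition letters :: "('d, 's, 'i, 'x) apc \<Rightarrow> ('s, 'i) letter set" where
  "letters \<PP> = Internal ` internals \<PP> \<union> Post ` handlers \<PP> \<union> Cancel ` handlers \<PP>"

definition is_apc :: "('d, 's, 'i, 'x) apc \<Rightarrow> bool" where
  "is_apc \<PP> \<longleftrightarrow>
     finite (states \<PP>) \<and> finite (handlers \<PP>) \<and> finite (internals \<PP>) \<and> finite (nonterms \<PP>) \<and>
     prods \<PP> \<subseteq> nonterms \<PP> \<times>
       ({[N Y, N Z] | Y Z. Y \<in> nonterms \<PP> \<and> Z \<in> nonterms \<PP>} \<union> {[T a] | a. a \<in> letters \<PP>} \<union> {[]}) \<and>
     dom (nonterm_of \<PP>) = handlers \<PP> \<and> ran (nonterm_of \<PP>) \<subseteq> nonterms \<PP> \<and>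
     moves \<PP> \<subseteq> states \<PP> \<times>
       ({[T a, N d] | a d. a \<in> letters \<PP> \<and> d \<in> states \<PP>} \<union> {[]}) \<and>
     init_state \<PP> \<in> states \<PP> \<and> set_mset (init_tasks \<PP>) \<subseteq> handlers \<PP>"

type_synonym ('d, 's) config = "'d \<times> 's multiset"

definition configs :: "('d, 's, 'i, 'x) apc \<Rightarrow> ('d, 's) config set" where
  "configs \<PP> = states \<PP> \<times> {m. set_mset m \<subseteq> handlers \<PP>}"

text \<open>
  Here \<open>m\<close> is the multiset of pending tasks after the dispatched copy of \<open>\<sigma>\<close> has been removed.
  Only what is posted after the last cancellation of \<open>b\<close> survives; if \<open>b\<close> is never cancelled, the
  tasks already pending survive as well.
\<close>

definition step :: "('d, 's, 'i, 'x) apc \<Rightarrow> ('d, 's) config \<Rightarrow> 's \<Rightarrow> ('d, 's) config \<Rightarrow> bool" where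
  "step \<PP> c \<sigma> c' \<longleftrightarrow>
     c \<in> configs \<PP> \<and> c' \<in> configs \<PP> \<and> \<sigma> \<in> handlers \<PP> \<and>
     (\<exists>d m d' m' X w.
        c = (d, m + {#\<sigma>#}) \<and> c' = (d', m') \<and>
        w \<in> lists (letters \<PP>) \<and>
        derives (moves \<PP>) [N d] (map T w @ [N d']) \<and>
        nonterm_of \<PP> \<sigma> = Some X \<and> derives (prods \<PP>) [N X] (map T w) \<and>
        (\<forall>b\<in>handlers \<PP>.
           (\<exists>w1 w2. w = w1 @ [Cancel b] @ w2 \<and> w2 \<in> lists (letters \<PP> - {Cancel b}) \<and>
                    count m' b = count_list w2 (Post b)) \<or>
           (w \<in> lists (letters \<PP> - {Cancel b}) \<and>
            count m' b = count m b + count_list w (Post b))))"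

definition pending :: "'s \<Rightarrow> ('d, 's) config \<Rightarrow> bool" where
  "pending \<sigma> c \<longleftrightarrow> count (snd c) \<sigma> > 0"

text \<open>
  A run is given by its configurations \<open>c j\<close> together with the handlers \<open>s j\<close> dispatched in the
  transitions from \<open>c j\<close> to \<open>c (Suc j)\<close>.
\<close>

definition infinite_run ::
  "('d, 's, 'i, 'x) apc \<Rightarrow> (nat \<Rightarrow> ('d, 's) config) \<Rightarrow> (nat \<Rightarrow> 's) \<Rightarrow> bool" where
  "infinite_run \<PP> c s \<longleftrightarrow>
     c 0 = (init_state \<PP>, init_tasks \<PP>) \<and> (\<forall>j. step \<PP> (c j) (s j) (c (Suc j)))"

definition fair_run ::
  "('d, 's, 'i, 'x) apc \<Rightarrow> (nat \<Rightarrow> ('d, 's) config) \<Rightarrow> (nat \<Rightarrow> 's) \<Rightarrow> bool" where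
  "fair_run \<PP> c s \<longleftrightarrow> infinite_run \<PP> c s \<and>
     (\<forall>\<sigma>\<in>handlers \<PP>. finite {j. s j = \<sigma>} \<longrightarrow> infinite {j. \<not> pending \<sigma> (c j)})"

definition fairly_starves ::
  "('d, 's, 'i, 'x) apc \<Rightarrow> (nat \<Rightarrow> ('d, 's) config) \<Rightarrow> (nat \<Rightarrow> 's) \<Rightarrow> 's \<Rightarrow> bool" where
  "fairly_starves \<PP> c s a \<longleftrightarrow> fair_run \<PP> c s \<and>
     (\<exists>J. \<forall>j\<ge>J. count (snd (c j)) a \<ge> 1 \<and> (s j = a \<longrightarrow> count (snd (c j)) a \<ge> 2))"

definition has_fair_infinite_run :: "('d, 's, 'i, 'x) apc \<Rightarrow> bool" where
  "has_fair_infinite_run \<PP> \<longleftrightarrow> (\<exists>c s. fair_run \<PP> c s)"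

definition has_fairly_starving_run :: "('d, 's, 'i, 'x) apc \<Rightarrow> bool" where
  "has_fairly_starving_run \<PP> \<longleftrightarrow> (\<exists>a\<in>handlers \<PP>. \<exists>c s. fairly_starves \<PP> c s a)"


section \<open>Partial recursive functions\<close>

datatype recf = Zero | Succ | Proj nat | Comp recf "recf list" | PrimRec recf recf | Mu recf

text \<open>
  \<open>computes f xs y\<close>: the partial recursive function described by \<open>f\<close> is defined on the argument
  tuple \<open>xs\<close> and has value \<open>y\<close>.  Recursion and minimisation act on the first argument.
\<close>

inductive computes :: "recf \<Rightarrow> nat list \<Rightarrow> nat \<Rightarrow> bool" where
  "computes Zero xs 0"
| "computes Succ [x] (Suc x)"
| "i < length xs \<Longrightarrow> computes (Proj i) xs (xs ! i)"
| "list_all2 (\<lambda>g y. computes g xs y) gs ys \<Longrightarrow> computes f ys z \<Longrightarrow> computes (Comp f gs) xs z"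
| "computes f xs y \<Longrightarrow> computes (PrimRec f g) (0 # xs) y"
| "computes (PrimRec f g) (n # xs) y \<Longrightarrow> computes g (n # y # xs) z \<Longrightarrow>
     computes (PrimRec f g) (Suc n # xs) z"
| "computes f (n # xs) 0 \<Longrightarrow> (\<forall>i<n. \<exists>y>0. computes f (i # xs) y) \<Longrightarrow> computes (Mu f) xs n"

lemma computes_functional: "computes f xs y \<Longrightarrow> computes f xs z \<Longrightarrow> y = z"
proof (induction f xs y arbitrary: z rule: computes.induct)
  case (4 xs gs ys f r)
  from \<open>computes (Comp f gs) xs z\<close> obtain ys' where ys': "list_all2 (\<lambda>g y. computes g xs y) gs ys'" "computes f ys' z"
    by (cases rule: computes.cases) auto
  have "ys = ys'"
    using 4 ys'(1) by (auto simp: list_all2_conv_all_nth intro!: nth_equalityI)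
  with ys'(2) show ?case using 4 by blast
next
  case (7 f n xs)
  from 7(4) have z: "computes f (z # xs) 0" "\<forall>i<z. \<exists>y>0. computes f (i # xs) y"
    by (cases rule: computes.cases, auto)+
  show ?case
  proof (rule linorder_cases[of n z])
    assume "n < z" with z(2) 7(2) show ?thesis by fastforce
  next
    assume "z < n" with z(1) 7(3) show ?thesis by fastforce
  qed simp
next
  case (1 xs)
  then show ?case by (cases rule: computes.cases) auto
next
  case (2 x)
  then show ?case by (cases rule: computes.cases) auto
next
  case (3 i xs)
  from 3(2) show ?case by (cases rule: computes.cases) auto
next
  case (5 f xs y g)
  from 5(3) show ?case by (cases rule: computes.cases) (auto dest: 5(2))
next
  case (6 f g n xs y r)
  from 6(5) obtain y' where "computes (PrimRec f g) (n # xs) y'" "computes g (n # y' # xs) z"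
    by (cases rule: computes.cases) auto
  with 6(3,4) show ?case by blast
qed


section \<open>Programs as inputs of algorithms\<close>

text \<open>
  As an input, a program has natural numbers as names of its states, handlers, internal actions
  and nonterminals, and its finite components are listed, in any order, by lists coded as numbers.
\<close>

fun letter_code :: "(nat, nat) letter \<Rightarrow> nat" where
  "letter_code (Internal i) = prod_encode (0, i)"
| "letter_code (Post \<sigma>) = prod_encode (1, \<sigma>)"
| "letter_code (Cancel \<sigma>) = prod_encode (2, \<sigma>)"

fun sym_code :: "(nat, (nat, nat) letter) sym \<Rightarrow> nat" where
  "sym_code (N x) = prod_encode (0, x)"
| "sym_code (T a) = prod_encode (1, letter_code a)"

definition prods_code :: "(nat \<times> (nat, (nat, nat) letter) sym list) list \<Rightarrow> nat" where
  "prods_code ps = list_encode (map (\<lambda>(A, \<alpha>). prod_encode (A, list_encode (map sym_code \<alpha>))) ps)"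

definition encodes :: "nat \<Rightarrow> (nat, nat, nat, nat) apc \<Rightarrow> bool" where
  "encodes n \<PP> \<longleftrightarrow>
     (\<exists>ds ss ks xs ps hs rs ms.
        set ds = states \<PP> \<and> set ss = handlers \<PP> \<and> set ks = internals \<PP> \<and> set xs = nonterms \<PP> \<and>
        set ps = prods \<PP> \<and> set hs = Map.graph (nonterm_of \<PP>) \<and> set rs = moves \<PP> \<and>
        mset ms = init_tasks \<PP> \<and>
        n = list_encode
              [list_encode ds, list_encode ss, list_encode ks, list_encode xs,
               prods_code ps, list_encode (map prod_encode hs), prods_code rs,
               init_state \<PP>, list_encode ms])"

lemma letter_code_eq_iff [simp]: "letter_code a = letter_code b \<longleftrightarrow> a = b"
  by (cases a; cases b) auto

lemma sym_code_eq_iff [simp]: "sym_code a = sym_code b \<longleftrightarrow> a = b"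
  by (cases a; cases b) auto

lemma prods_code_eq_iff [simp]: "prods_code ps = prods_code qs \<longleftrightarrow> ps = qs"
proof -
  have "inj sym_code" by (auto intro: injI)
  then have "inj (\<lambda>(A, \<alpha>). prod_encode (A :: nat, list_encode (map sym_code \<alpha>)))"
    by (auto intro!: injI simp: list_encode_eq inj_map_eq_map)
  then show ?thesis by (simp add: prods_code_def list_encode_eq)
qed

lemma encodes_unique:
  assumes "encodes n \<PP>" and "encodes n \<QQ>"
  shows "\<PP> = \<QQ>"
proof -
  have graph: "f = g" if "Map.graph f = Map.graph g" for f g :: "nat \<rightharpoonup> nat"
  proof (rule ext)
    fix x
    have "f x = Some y \<longleftrightarrow> g x = Some y" for y
      using that by (auto simp: graph_def set_eq_iff)
    then show "f x = g x" by (metis option.exhaust)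
  qed
  from assms(1) obtain ds ss ks xs ps hs rs ms where P:
    "set ds = states \<PP>" "set ss = handlers \<PP>" "set ks = internals \<PP>" "set xs = nonterms \<PP>"
    "set ps = prods \<PP>" "set hs = Map.graph (nonterm_of \<PP>)" "set rs = moves \<PP>"
    "mset ms = init_tasks \<PP>"
    "n = list_encode
           [list_encode ds, list_encode ss, list_encode ks, list_encode xs,
            prods_code ps, list_encode (map prod_encode hs), prods_code rs,
            init_state \<PP>, list_encode ms]"
    unfolding encodes_def by blast
  from assms(2) obtain ds' ss' ks' xs' ps' hs' rs' ms' where Q:
    "set ds' = states \<QQ>" "set ss' = handlers \<QQ>" "set ks' = internals \<QQ>" "set xs' = nonterms \<QQ>"
    "set ps' = prods \<QQ>" "set hs' = Map.graph (nonterm_of \<QQ>)" "set rs' = moves \<QQ>"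
    "mset ms' = init_tasks \<QQ>"
    "n = list_encode
           [list_encode ds', list_encode ss', list_encode ks', list_encode xs',
            prods_code ps', list_encode (map prod_encode hs'), prods_code rs',
            init_state \<QQ>, list_encode ms']"
    unfolding encodes_def by blast
  from P(9) Q(9) have eq: "ds = ds'" "ss = ss'" "ks = ks'" "xs = xs'" "ps = ps'" "hs = hs'"
    "rs = rs'" "init_state \<PP> = init_state \<QQ>" "ms = ms'"
    by (simp_all only: list_encode_eq list.inject prods_code_eq_iff inj_map_eq_map[OF inj_prod_encode])
  show ?thesis
  proof (rule apc.equality)
    show "nonterm_of \<PP> = nonterm_of \<QQ>"
      using P(6) Q(6) eq(6) by (simp add: graph)
  qed (use P(1-5,7,8) Q(1-5,7,8) eq in simp_all)
qed

lemma encodes_exists: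
  assumes "is_apc \<PP>"
  shows "\<exists>n. encodes n \<PP>"
proof -
  let ?L = "letters \<PP>" and ?X = "nonterms \<PP>"
  have fin: "finite (states \<PP>)" "finite (handlers \<PP>)" "finite (internals \<PP>)" "finite ?X"
    using assms by (auto simp: is_apc_def)
  then have L: "finite ?L" by (simp add: letters_def)
  have "prods \<PP> \<subseteq> ?X \<times> ((\<lambda>(Y, Z). [N Y, N Z]) ` (?X \<times> ?X) \<union> (\<lambda>a. [T a]) ` ?L \<union> {[]})"
    using assms unfolding is_apc_def by (elim conjE, elim subset_trans) auto
  then have fP: "finite (prods \<PP>)"
    by (rule finite_subset) (simp add: fin L)
  have "moves \<PP> \<subseteq> states \<PP> \<times> ((\<lambda>(a, d). [T a, N d]) ` (?L \<times> states \<PP>) \<union> {[]})"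
    using assms unfolding is_apc_def by (elim conjE, elim subset_trans) auto
  then have fM: "finite (moves \<PP>)"
    by (rule finite_subset) (simp add: fin L)
  have fG: "finite (Map.graph (nonterm_of \<PP>))"
    using assms fin by (simp add: is_apc_def)
  obtain ds ss ks xs ps hs rs ms where
    "set ds = states \<PP>" "set ss = handlers \<PP>" "set ks = internals \<PP>" "set xs = nonterms \<PP>"
    "set ps = prods \<PP>" "set hs = Map.graph (nonterm_of \<PP>)" "set rs = moves \<PP>"
    "mset ms = init_tasks \<PP>"
    by (metis fin fP fG fM finite_list ex_mset)
  then show ?thesis unfolding encodes_def by blast
qed

text \<open>
  A decision procedure only has to terminate, with answer 1 or 0, on codes of programs.
\<close>

definition decidable :: "((nat, nat, nat, nat) apc \<Rightarrow> bool) \<Rightarrow> bool" where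
  "decidable Q \<longleftrightarrow>
     (\<exists>f. \<forall>\<PP> n. is_apc \<PP> \<longrightarrow> encodes n \<PP> \<longrightarrow> computes f [n] (if Q \<PP> then 1 else 0))"

end

theory Submission
  imports Defs
begin

text \<open>
  Programs with cancel simulate counter machines: a pending task of a handler is a unit of a
  counter, and a test for zero cancels the tasks of the counter.  One more handler counts the sum of
  all counters.  If a counter is cancelled although it is not zero, then this sum is too large for
  ever.  When the machine has halted with all counters zero, the program may enter a last state in
  which only a dummy handler can be dispatched, so that fairness forces the sum to be zero and hence
  the simulation to be correct.  Before that, a handler that can only be dispatched on entering the
  last state is always pending, so that every fair run enters it.  As two copies of the dummy handler
  are around, it is starved by the run of a halting machine.  A machine that does not halt gives no
  fair run at all, so one reduction covers both problems.

  The diagonalisation needs no universal machine.  The program that runs the alleged decision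
  procedure gets all components of its own code but the last as initial counter values, and computes
  from them the last one, which lists its initial tasks.
\<close>

section \<open>Compiling recursive functions to counter programs\<close>

text \<open>There is no separate decrement: \<open>While r c\<close> takes a unit off
  \<open>r\<close> before each round, which is the test-and-decrement of a counter machine.\<close>

datatype com = Skip | Incr nat | Seq com com | While nat com

inductive exec :: "com \<Rightarrow> (nat \<Rightarrow> nat) \<Rightarrow> (nat \<Rightarrow> nat) \<Rightarrow> bool" where
  Skip: "exec Skip s s"
| Incr: "exec (Incr r) s (s(r := Suc (s r)))"
| Seq: "exec c s t \<Longrightarrow> exec d t u \<Longrightarrow> exec (Seq c d) s u"
| While_zero: "s r = 0 \<Longrightarrow> exec (While r c) s s"
| While_pos: "s r > 0 \<Longrightarrow> exec c (s(r := s r - 1)) t \<Longrightarrow> exec (While r c) t u \<Longrightarrow>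
    exec (While r c) s u"

lemma exec_eq: "exec c s t \<Longrightarrow> t = u \<Longrightarrow> exec c s u"
  by simp

section \<open>Clearing, moving and copying registers\<close>

lemma exec_clear: "exec (While r Skip) s (s(r := 0))"
proof (induction "s r" arbitrary: s)
  case 0
  then show ?case by (intro exec_eq[OF exec.While_zero]) auto
next
  case (Suc n)
  from Suc(2) have "exec (While r Skip) (s(r := s r - 1)) ((s(r := s r - 1))(r := 0))"
    by (intro Suc(1)) simp
  then have "exec (While r Skip) (s(r := s r - 1)) (s(r := 0))" by simp
  with Suc(2) show ?case by (metis exec.While_pos exec.Skip zero_less_Suc)
qed

lemma exec_move:
  assumes "a \<noteq> b"
  shows "exec (While a (Incr b)) s (s(a := 0, b := s b + s a))"
proof (induction "s a" arbitrary: s)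
  case 0
  then show ?case by (auto intro!: exec_eq[OF exec.While_zero])
next
  case (Suc n)
  let ?t = "s(a := s a - 1, b := Suc (s b))"
  have 1: "exec (Incr b) (s(a := s a - 1)) ?t"
    by (rule exec_eq[OF exec.Incr]) (use assms in auto)
  have 2: "exec (While a (Incr b)) ?t (?t(a := 0, b := ?t b + ?t a))"
    by (rule Suc(1)) (use Suc(2) assms in auto)
  have "exec (While a (Incr b)) s (?t(a := 0, b := ?t b + ?t a))"
    by (rule exec.While_pos[OF _ 1 2]) (use Suc(2) in simp)
  then show ?case by (rule exec_eq) (use Suc(2) assms in auto)
qed

lemma exec_move2:
  assumes "a \<noteq> b" "a \<noteq> c" "b \<noteq> c"
  shows "exec (While a (Seq (Incr b) (Incr c))) s (s(a := 0, b := s b + s a, c := s c + s a))"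
proof (induction "s a" arbitrary: s)
  case 0
  then show ?case by (auto intro!: exec_eq[OF exec.While_zero])
next
  case (Suc n)
  let ?t = "s(a := s a - 1, b := Suc (s b), c := Suc (s c))"
  have 1: "exec (Seq (Incr b) (Incr c)) (s(a := s a - 1)) ?t"
    by (rule exec_eq[OF exec.Seq[OF exec.Incr exec.Incr]]) (use assms in auto)
  have 2: "exec (While a (Seq (Incr b) (Incr c))) ?t
      (?t(a := 0, b := ?t b + ?t a, c := ?t c + ?t a))"
    by (rule Suc(1)) (use Suc(2) assms in auto)
  have "exec (While a (Seq (Incr b) (Incr c))) s (?t(a := 0, b := ?t b + ?t a, c := ?t c + ?t a))"
    by (rule exec.While_pos[OF _ 1 2]) (use Suc(2) in simp)
  then show ?case by (rule exec_eq) (use Suc(2) assms in auto)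
qed

text \<open>A loop destroys the register it runs on, so \<open>a\<close> is first emptied into both
  \<open>b\<close> and the buffer \<open>t\<close> and then refilled from \<open>t\<close>.\<close>

definition copy :: "nat \<Rightarrow> nat \<Rightarrow> nat \<Rightarrow> com" where
  "copy a b t = Seq (While a (Seq (Incr b) (Incr t))) (While t (Incr a))"

lemma exec_copy:
  assumes "a \<noteq> b" "a \<noteq> t" "b \<noteq> t" "s t = 0"
  shows "exec (copy a b t) s (s(b := s b + s a))"
  unfolding copy_def
  by (rule exec_eq[OF exec.Seq[OF exec_move2 exec_move]]) (use assms in auto)

primrec clears :: "nat list \<Rightarrow> com" where
  "clears [] = Skip"
| "clears (r # rs) = Seq (While r Skip) (clears rs)"

lemma exec_clears: "exec (clears rs) s (\<lambda>r. if r \<in> set rs then 0 else s r)"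
proof (induction rs arbitrary: s)
  case Nil
  then show ?case by (simp add: exec.Skip)
next
  case (Cons r rs)
  show ?case
    unfolding clears.simps
    by (rule exec_eq[OF exec.Seq[OF exec_clear Cons.IH]]) auto
qed

primrec calls :: "(nat list \<Rightarrow> nat \<Rightarrow> nat \<Rightarrow> com) list \<Rightarrow> nat list \<Rightarrow> nat \<Rightarrow> nat \<Rightarrow> com" where
  "calls [] as out fr = Skip"
| "calls (g # gs) as out fr = Seq (g as out fr) (calls gs as (Suc out) fr)"

text \<open>
  \<open>compile f as out fr\<close> reads its arguments from the registers \<open>as\<close>, writes to \<open>out\<close>, and may use
  the registers from \<open>fr\<close> on as scratch space, which it finds and leaves zero.
\<close>

primrec compile :: "recf \<Rightarrow> nat list \<Rightarrow> nat \<Rightarrow> nat \<Rightarrow> com" where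
  "compile Zero = (\<lambda>as out fr. Skip)"
| "compile Succ = (\<lambda>as out fr. Seq (copy (hd as) out fr) (Incr out))"
| "compile (Proj i) = (\<lambda>as out fr. copy (as ! i) out fr)"
| "compile (Comp f gs) = (\<lambda>as out fr.
     let fr' = fr + length gs in
       Seq (calls (map compile gs) as fr fr')
         (Seq (compile f [fr..<fr'] out fr') (clears [fr..<fr'])))"
| "compile (PrimRec f g) = (\<lambda>as out fr.
     let n = fr; k = fr + 1; acc = fr + 2; tmp = fr + 3; fr' = fr + 4 in
       Seq (copy (hd as) n tmp)
         (Seq (compile f (tl as) acc fr')
           (Seq (While n
               (Seq (compile g (k # acc # tl as) tmp fr')
                 (Seq (While acc Skip) (Seq (While tmp (Incr acc)) (Incr k)))))
             (Seq (While acc (Incr out)) (While k Skip)))))"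
| "compile (Mu f) = (\<lambda>as out fr.
     let k = fr; tmp = fr + 1; fr' = fr + 2 in
       Seq (compile f (k # as) tmp fr')
         (Seq (While tmp
             (Seq (While tmp Skip) (Seq (Incr k) (compile f (k # as) tmp fr'))))
           (While k (Incr out))))"

text \<open>Only arguments with a value are constrained, and a decision procedure has one on every
  code. The exact final state says that arguments and scratch registers are restored, which lets
  calls be composed.\<close>

definition implements :: "(nat list \<Rightarrow> nat \<Rightarrow> nat \<Rightarrow> com) \<Rightarrow> recf \<Rightarrow> bool" where
  "implements c f \<longleftrightarrow> (\<forall>as out fr s y. computes f (map s as) y \<longrightarrow> out < fr \<longrightarrow> set as \<subseteq> {..<fr} \<longrightarrow>
     out \<notin> set as \<longrightarrow> s out = 0 \<longrightarrow> (\<forall>r\<ge>fr. s r = 0) \<longrightarrow> exec (c as out fr) s (s(out := y)))"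

lemma implementsD:
  assumes "implements c f" "computes f xs y" "map s as = xs" "out < fr" "set as \<subseteq> {..<fr}"
    "out \<notin> set as" "s out = 0" "\<And>r. r \<ge> fr \<Longrightarrow> s r = 0"
  shows "exec (c as out fr) s (s(out := y))"
  using assms unfolding implements_def by blast

lemma exec_calls:
  assumes "list_all2 (\<lambda>g y. computes g xs y) gs ys" "\<And>g. g \<in> set gs \<Longrightarrow> implements (c g) g"
    "map s as = xs" "set as \<subseteq> {..<out}" "out + length gs \<le> fr" "\<And>r. r \<ge> out \<Longrightarrow> s r = 0"
  shows "exec (calls (map c gs) as out fr) s
     (\<lambda>r. if out \<le> r \<and> r < out + length gs then ys ! (r - out) else s r)"
  using assms
proof (induction gs ys arbitrary: s out rule: list_all2_induct)
  case Nil
  have "(\<lambda>r. if out \<le> r \<and> r < out + length [] then [] ! (r - out) else s r) = s" by auto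
  then show ?case by (simp add: exec.Skip)
next
  case (Cons g gs y ys)
  let ?s = "s(out := y)"
  have 1: "exec (c g as out fr) s ?s"
    by (rule implementsD[of _ g xs]) (use Cons.prems Cons.hyps in auto)
  have as: "map ?s as = map s as" using Cons.prems(3) by auto
  have 2: "exec (calls (map c gs) as (Suc out) fr) ?s
      (\<lambda>r. if Suc out \<le> r \<and> r < Suc out + length gs then ys ! (r - Suc out) else ?s r)"
    by (rule Cons.IH) (use Cons.prems as in auto)
  show ?case
    unfolding list.map calls.simps
    by (rule exec_eq[OF exec.Seq[OF 1 2]]) (auto simp: fun_eq_iff nth_Cons' Suc_le_eq)
qed

section \<open>Correctness of the compiled code, constructor by constructor\<close>

inductive_cases computes_ZeroE: "computes Zero xs y"
inductive_cases computes_SuccE: "computes Succ xs y"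
inductive_cases computes_ProjE: "computes (Proj i) xs y"
inductive_cases computes_CompE: "computes (Comp f gs) xs y"
inductive_cases computes_PrimRecE: "computes (PrimRec f g) xs y"
inductive_cases computes_PrimRec_0E: "computes (PrimRec f g) (0 # xs) y"
inductive_cases computes_PrimRec_SucE: "computes (PrimRec f g) (Suc n # xs) y"
inductive_cases computes_MuE: "computes (Mu f) xs y"

text \<open>The history \<open>h\<close> of intermediate values turns the downward recursion of
  \<open>computes\<close> into the upward order in which the loop runs.\<close>

lemma computes_PrimRec_values:
  assumes "computes (PrimRec f g) (n # xs) y"
  shows "\<exists>h. computes f xs (h 0) \<and> (\<forall>i<n. computes g (i # h i # xs) (h (Suc i))) \<and> h n = y"
  using assms
proof (induction n arbitrary: y)
  case 0
  then have "computes f xs y" by (elim computes_PrimRec_0E)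
  then show ?case by (intro exI[of _ "\<lambda>_. y"]) simp
next
  case (Suc n)
  from Suc.prems obtain z where z: "computes (PrimRec f g) (n # xs) z" "computes g (n # z # xs) y"
    by (elim computes_PrimRec_SucE)
  from Suc.IH[OF z(1)] obtain h where
    "computes f xs (h 0)" "\<forall>i<n. computes g (i # h i # xs) (h (Suc i))" "h n = z" by blast
  with z(2) show ?case
    by (intro exI[of _ "h(Suc n := y)"]) (auto simp: less_Suc_eq)
qed

lemma implements_Comp:
  assumes f: "implements (compile f) f" and gs: "\<And>g. g \<in> set gs \<Longrightarrow> implements (compile g) g"
  shows "implements (compile (Comp f gs)) (Comp f gs)"
  unfolding implements_def
proof (intro allI impI)
  fix as and out fr z :: nat and s :: "nat \<Rightarrow> nat"
  assume "computes (Comp f gs) (map s as) z" and *: "out < fr" "set as \<subseteq> {..<fr}" "out \<notin> set as"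
    "s out = 0" "\<forall>r\<ge>fr. s r = 0"
  then obtain ys where ys: "list_all2 (\<lambda>g y. computes g (map s as) y) gs ys" "computes f ys z"
    by (elim computes_CompE)
  then have len: "length ys = length gs" by (simp add: list_all2_lengthD)
  let ?fr = "fr + length gs"
  let ?t = "\<lambda>r. if fr \<le> r \<and> r < ?fr then ys ! (r - fr) else s r"
  have 1: "exec (calls (map compile gs) as fr ?fr) s ?t"
    by (rule exec_calls[OF ys(1)]) (use gs * in auto)
  have "map ?t [fr..<?fr] = ys"
    by (rule nth_equalityI) (auto simp: len)
  then have 2: "exec (compile f [fr..<?fr] out ?fr) ?t (?t(out := z))"
    by (intro implementsD[OF f ys(2)]) (use * in auto)
  show "exec (compile (Comp f gs) as out fr) s (s(out := z))"
    unfolding compile.simps Let_def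
    by (rule exec_eq[OF exec.Seq[OF 1 exec.Seq[OF 2 exec_clears]]]) (use * in \<open>auto simp: fun_eq_iff\<close>)
qed

lemma implements_PrimRec:
  assumes f: "implements (compile f) f" and g: "implements (compile g) g"
  shows "implements (compile (PrimRec f g)) (PrimRec f g)"
  unfolding implements_def
proof (intro allI impI)
  fix as and out fr z :: nat and s :: "nat \<Rightarrow> nat"
  assume comp: "computes (PrimRec f g) (map s as) z" and *: "out < fr" "set as \<subseteq> {..<fr}"
    "out \<notin> set as" "s out = 0" "\<forall>r\<ge>fr. s r = 0"
  from comp obtain a as' where as: "as = a # as'"
    by (cases as) (auto elim: computes_PrimRecE)
  let ?N = "s a"
  from comp have "computes (PrimRec f g) (?N # map s as') z" by (simp add: as)
  from computes_PrimRec_values[OF this] obtain h where h: "computes f (map s as') (h 0)"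
    "\<And>i. i < ?N \<Longrightarrow> computes g (i # h i # map s as') (h (Suc i))" "h ?N = z" by blast
  \<comment> \<open>State before round \<open>i\<close>: the rounds left, the index of the round and
    the value of the recursion so far.\<close>
  let ?st = "\<lambda>i. s(fr := ?N - i, fr + 1 := i, fr + 2 := h i)"
  have mp: "map (s(fr := x, fr + 1 := x1, fr + 2 := x2)) as' = map s as'" for x x1 x2
    using *(2) as by auto
  have "map (s(fr := ?N)) as' = map s as'" using *(2) as by auto
  then have init: "exec (compile f as' (fr + 2) (fr + 4)) (s(fr := ?N)) ((s(fr := ?N))(fr + 2 := h 0))"
    by (intro implementsD[OF f h(1)]) (use * as in auto)
  let ?body = "Seq (compile g ((fr + 1) # (fr + 2) # as') (fr + 3) (fr + 4))
    (Seq (While (fr + 2) Skip) (Seq (While (fr + 3) (Incr (fr + 2))) (Incr (fr + 1))))"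
  \<comment> \<open>Backward induction from \<open>?N\<close>, because \<open>While_pos\<close> adds
    a round in front.\<close>
  have loop: "exec (While fr ?body) (?st i) (?st ?N)" if "i \<le> ?N" for i
    using that
  proof (induction rule: inc_induct)
    case base
    then show ?case by (intro exec.While_zero) simp
  next
    case (step i)
    let ?u = "(?st i)(fr := ?N - Suc i)"
    have g1: "exec (compile g ((fr + 1) # (fr + 2) # as') (fr + 3) (fr + 4)) ?u (?u(fr + 3 := h (Suc i)))"
      by (rule implementsD[OF g h(2)[OF step(2)]]) (use * as mp in auto)
    have body: "exec ?body ?u (?st (Suc i))"
      by (rule exec_eq[OF exec.Seq[OF g1 exec.Seq[OF exec_clear exec.Seq[OF exec_move exec.Incr]]]])
        (use * in \<open>auto simp: fun_eq_iff\<close>)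
    have "?u = (?st i)(fr := ?st i fr - 1)" by (simp add: fun_eq_iff)
    with body have body': "exec ?body ((?st i)(fr := ?st i fr - 1)) (?st (Suc i))" by simp
    show ?case
      by (rule exec.While_pos[OF _ body' step.IH]) (use step(2) in auto)
  qed
  have "?st 0 = (s(fr := ?N))(fr + 2 := h 0)" using * by (auto simp: fun_eq_iff)
  with loop[of 0] have loop0: "exec (While fr ?body) ((s(fr := ?N))(fr + 2 := h 0)) (?st ?N)" by simp
  have copy: "exec (copy a fr (fr + 3)) s (s(fr := ?N))"
    by (rule exec_eq[OF exec_copy]) (use * as in auto)
  show "exec (compile (PrimRec f g) as out fr) s (s(out := z))"
    unfolding compile.simps Let_def as list.sel
    by (rule exec_eq[OF exec.Seq[OF copy exec.Seq[OF init exec.Seq[OF loop0 exec.Seq[OF exec_move exec_clear]]]]])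
      (use * h(3) in \<open>auto simp: fun_eq_iff\<close>)
qed

lemma implements_Mu:
  assumes f: "implements (compile f) f"
  shows "implements (compile (Mu f)) (Mu f)"
  unfolding implements_def
proof (intro allI impI)
  fix as and out fr z :: nat and s :: "nat \<Rightarrow> nat"
  assume "computes (Mu f) (map s as) z" and *: "out < fr" "set as \<subseteq> {..<fr}"
    "out \<notin> set as" "s out = 0" "\<forall>r\<ge>fr. s r = 0"
  then have z: "computes f (z # map s as) 0" "\<forall>i<z. \<exists>y>0. computes f (i # map s as) y"
    by (elim computes_MuE; simp)+
  \<comment> \<open>\<open>v i\<close> is the content of register \<open>fr + 1\<close> after the
    call with index \<open>i\<close>: positive before \<open>z\<close> and zero at \<open>z\<close>,
    so the loop stops exactly there.\<close>
  define v where "v i = (if i = z then 0 else (SOME y. y > 0 \<and> computes f (i # map s as) y))" for i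
  have v: "v i > 0 \<and> computes f (i # map s as) (v i)" if "i < z" for i
  proof -
    have "\<exists>y. y > 0 \<and> computes f (i # map s as) y" using z(2) that by auto
    from someI_ex[OF this] show ?thesis using that by (simp add: v_def)
  qed
  have vz: "v z = 0" by (simp add: v_def)
  have v': "computes f (i # map s as) (v i)" if "i \<le> z" for i
    using v[of i] z(1) vz that by (cases "i = z") auto
  have call: "exec (compile f (fr # as) (fr + 1) (fr + 2)) (s(fr := i)) (s(fr := i, fr + 1 := v i))"
    if "i \<le> z" for i
  proof -
    have "map (s(fr := i)) as = map s as" using *(2) by auto
    then show ?thesis by (intro implementsD[OF f v'[OF that]]) (use * in auto)
  qed
  let ?body = "Seq (While (fr + 1) Skip) (Seq (Incr fr) (compile f (fr # as) (fr + 1) (fr + 2)))"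
  have loop: "exec (While (fr + 1) ?body) (s(fr := i, fr + 1 := v i)) (s(fr := z, fr + 1 := 0))"
    if "i \<le> z" for i
    using that
  proof (induction rule: inc_induct)
    case base
    then show ?case using vz by (auto intro: exec_eq[OF exec.While_zero])
  next
    case (step i)
    let ?u = "s(fr := i, fr + 1 := v i)"
    \<comment> \<open>Entering the round has already taken one unit off \<open>fr + 1\<close>;
      \<open>exec_clear\<close> removes the rest, as the next call expects zero there.\<close>
    have "exec (Incr fr) (?u(fr + 1 := ?u (fr + 1) - 1, fr + 1 := 0)) (s(fr := Suc i))"
      by (rule exec_eq[OF exec.Incr]) (use * in \<open>auto simp: fun_eq_iff\<close>)
    then have body: "exec ?body (?u(fr + 1 := ?u (fr + 1) - 1)) (s(fr := Suc i, fr + 1 := v (Suc i)))"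
      by (intro exec.Seq[OF exec_clear] exec.Seq[OF _ call]) (use step(2) in auto)
    show ?case
      by (rule exec.While_pos[OF _ body step.IH]) (use v[OF step(2)] in auto)
  qed
  have "s(fr := 0) = s" using * by auto
  with call[of 0] have call0: "exec (compile f (fr # as) (fr + 1) (fr + 2)) s (s(fr := 0, fr + 1 := v 0))"
    by simp
  show "exec (compile (Mu f) as out fr) s (s(out := z))"
    unfolding compile.simps Let_def
    by (rule exec_eq[OF exec.Seq[OF call0 exec.Seq[OF loop exec_move]]]) (use * in \<open>auto simp: fun_eq_iff\<close>)
qed

lemma implements_compile: "implements (compile f) f"
proof (induction f)
  case Zero
  show ?case
    unfolding implements_def
    by (auto elim!: computes_ZeroE intro!: exec_eq[OF exec.Skip])
next
  case Succ
  show ?case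
    unfolding implements_def
    by (auto elim!: computes_SuccE intro!: exec_eq[OF exec.Seq[OF exec_copy exec.Incr]])
next
  case (Proj i)
  show ?case
    unfolding implements_def compile.simps
  proof (intro allI impI)
    fix as and out fr y :: nat and s :: "nat \<Rightarrow> nat"
    assume "computes (Proj i) (map s as) y" and *: "out < fr" "set as \<subseteq> {..<fr}" "out \<notin> set as"
      "s out = 0" "\<forall>r\<ge>fr. s r = 0"
    then have "i < length as" and y: "y = s (as ! i)" by (auto elim: computes_ProjE)
    then have "as ! i \<in> set as" by simp
    with * have "as ! i < fr" "as ! i \<noteq> out" by blast+
    with * y show "exec (copy (as ! i) out fr) s (s(out := y))"
      by (intro exec_eq[OF exec_copy]) auto
  qed
qed (fact implements_Comp implements_PrimRec implements_Mu)+

section \<open>Counter machines\<close>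

datatype instr = Inc nat nat | Dec nat nat nat | Jump nat

text \<open>Total and deterministic: an address outside \<open>P\<close> is a fixed point, so
  halting means reaching such an address.\<close>

fun cstep :: "instr list \<Rightarrow> nat \<times> (nat \<Rightarrow> nat) \<Rightarrow> nat \<times> (nat \<Rightarrow> nat)" where
  "cstep P (l, s) = (if l < length P then
     (case P ! l of
        Inc r k \<Rightarrow> (k, s(r := Suc (s r)))
      | Dec r k z \<Rightarrow> if s r = 0 then (z, s) else (k, s(r := s r - 1))
      | Jump k \<Rightarrow> (k, s))
     else (l, s))"

definition creach :: "instr list \<Rightarrow> nat \<times> (nat \<Rightarrow> nat) \<Rightarrow> nat \<times> (nat \<Rightarrow> nat) \<Rightarrow> bool" where
  "creach P c c' \<longleftrightarrow> (\<exists>n. (cstep P ^^ n) c = c')"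

lemma creach_refl: "creach P c c"
  unfolding creach_def by (rule exI[of _ 0]) simp

lemma creach_trans: "creach P c c' \<Longrightarrow> creach P c' c'' \<Longrightarrow> creach P c c''"
  unfolding creach_def by (metis comp_apply funpow_add)

lemma creach_step: "creach P c (cstep P c)"
  unfolding creach_def by (rule exI[of _ 1]) simp

section \<open>Machine code for commands\<close>

fun com_length :: "com \<Rightarrow> nat" where
  "com_length (Seq c d) = com_length c + com_length d"
| "com_length (While r c) = Suc (com_length c)"
| "com_length _ = 1"

text \<open>\<open>code i c k\<close> is the code of \<open>c\<close> when placed at address \<open>i\<close>, leaving to address \<open>k\<close>.\<close>

fun code :: "nat \<Rightarrow> com \<Rightarrow> nat \<Rightarrow> instr list" where
  "code i Skip k = [Jump k]"
| "code i (Incr r) k = [Inc r k]"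
| "code i (Seq c d) k = code i c (i + com_length c) @ code (i + com_length c) d k"
| "code i (While r c) k = Dec r (Suc i) k # code (Suc i) c i"

lemma length_code [simp]: "length (code i c k) = com_length c"
  by (induction c arbitrary: i k) auto

fun regs :: "com \<Rightarrow> nat set" where
  "regs Skip = {}"
| "regs (Incr r) = {r}"
| "regs (Seq c d) = regs c \<union> regs d"
| "regs (While r c) = insert r (regs c)"

lemma finite_regs: "finite (regs c)"
  by (induction c) auto

fun instr_regs :: "instr \<Rightarrow> nat set" where
  "instr_regs (Inc r k) = {r}"
| "instr_regs (Dec r k z) = {r}"
| "instr_regs (Jump k) = {}"

fun targets :: "instr \<Rightarrow> nat set" where
  "targets (Inc r k) = {k}"
| "targets (Dec r k z) = {k, z}"
| "targets (Jump k) = {k}"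

lemma regs_code: "I \<in> set (code i c k) \<Longrightarrow> instr_regs I \<subseteq> regs c"
proof (induction c arbitrary: i k)
  case (Seq c d)
  then show ?case unfolding code.simps set_append regs.simps by blast
next
  case (While r c)
  then show ?case by (cases "I = Dec r (Suc i) k") auto
qed auto

text \<open>For \<open>i = 0\<close> and \<open>k = com_length c\<close> this bounds all targets by
  the length of the program, as the locale \<open>counter_machine\<close> demands.\<close>

lemma targets_code: "I \<in> set (code i c k) \<Longrightarrow> targets I \<subseteq> {i..i + com_length c} \<union> {k}"
proof (induction c arbitrary: i k)
  case (Seq c d)
  consider "I \<in> set (code i c (i + com_length c))" | "I \<in> set (code (i + com_length c) d k)"
    using Seq.prems by auto
  then show ?case
  proof cases
    case 1
    from Seq.IH(1)[OF this] show ?thesis by auto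
  next
    case 2
    from Seq.IH(2)[OF this] show ?thesis by auto
  qed
next
  case (While r c)
  then consider "I = Dec r (Suc i) k" | "I \<in> set (code (Suc i) c i)" by auto
  then show ?case
  proof cases
    case 2
    from While.IH[OF this] show ?thesis by auto
  qed auto
qed auto

primrec placed :: "instr list \<Rightarrow> nat \<Rightarrow> instr list \<Rightarrow> bool" where
  "placed P i [] \<longleftrightarrow> True"
| "placed P i (I # Is) \<longleftrightarrow> i < length P \<and> P ! i = I \<and> placed P (Suc i) Is"

lemma placed_append: "placed P i (Is @ Js) \<longleftrightarrow> placed P i Is \<and> placed P (i + length Is) Js"
  by (induction Is arbitrary: i) auto

lemma placed_self: "placed (Is @ P) (length Is) P"
proof (induction P arbitrary: Is)
  case (Cons I P)
  from Cons[of "Is @ [I]"] show ?case by simp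
qed simp

text \<open>By induction on the execution and not on the command: after a round, the same loop at
  the same address runs again.\<close>

lemma creach_code:
  assumes "exec c s t" "placed P i (code i c k)"
  shows "creach P (i, s) (k, t)"
  using assms
proof (induction arbitrary: i k rule: exec.induct)
  case (Skip s)
  then show ?case using creach_step[of P "(i, s)"] by simp
next
  case (Incr r s)
  then show ?case using creach_step[of P "(i, s)"] by (simp add: fun_upd_def)
next
  case (Seq c s t d u)
  then have "creach P (i, s) (i + com_length c, t)" "creach P (i + com_length c, t) (k, u)"
    by (simp_all add: placed_append)
  then show ?case by (rule creach_trans)
next
  case (While_zero s r c)
  then show ?case using creach_step[of P "(i, s)"] by simp
next
  case (While_pos s r c t u)
  have "creach P (i, s) (Suc i, s(r := s r - 1))"
    using While_pos.hyps(1) While_pos.prems creach_step[of P "(i, s)"] by simp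
  moreover have "creach P (Suc i, s(r := s r - 1)) (i, t)"
    using While_pos.prems by (intro While_pos.IH) simp
  moreover have "creach P (i, t) (k, u)"
    using While_pos.prems by (intro While_pos.IH) simp
  ultimately show ?case by (meson creach_trans)
qed

lemma cstep_stuck: "length P \<le> fst c \<Longrightarrow> (cstep P ^^ n) c = c"
proof (induction n)
  case (Suc n)
  then show ?case by (cases c) simp
qed simp

text \<open>The loop keeps the register \<open>r\<close> alternating between one and zero.\<close>

lemma diverges_code:
  assumes reach: "creach P c (i, s)" and P: "placed P i (code i (While r (Incr r)) k)" and r: "s r = 1"
    and c': "creach P c c'"
  shows "fst c' < length P"
proof (rule ccontr)
  let ?C = "{(i, s), (Suc i, s(r := 0))}"
  have loop: "(cstep P ^^ n) (i, s) \<in> ?C" for n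
  proof (induction n)
    case (Suc n)
    have "cstep P x \<in> ?C" if "x \<in> ?C" for x
      using P that r by (auto simp: fun_eq_iff)
    from this[OF Suc.IH] show ?case by (simp only: funpow.simps comp_apply)
  qed simp
  have lt: "fst x < length P" if "x \<in> ?C" for x
    using P that by auto
  assume stuck: "\<not> fst c' < length P"
  from reach c' obtain n m where nm: "(cstep P ^^ n) c = (i, s)" "(cstep P ^^ m) c = c'"
    unfolding creach_def by blast
  show False
  \<comment> \<open>By determinism \<open>c'\<close> comes either after the loop is entered or
    before it. In the latter case a halted \<open>c'\<close>, being a fixed point, could not lead
    into the loop.\<close>
  proof (cases "n \<le> m")
    case True
    then obtain d where "m = d + n" by (metis add.commute le_Suc_ex)
    with nm have "c' = (cstep P ^^ d) (i, s)" by (auto simp: funpow_add)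
    with lt[OF loop[of d]] stuck show False by simp
  next
    case False
    then obtain d where "n = d + m" by (metis add.commute le_Suc_ex nat_le_linear)
    with nm have "(i, s) = (cstep P ^^ d) c'" by (auto simp: funpow_add)
    with cstep_stuck[of P c' d] stuck have "c' = (i, s)" by simp
    with lt[of "(i, s)"] stuck show False by simp
  qed
qed

section \<open>Computing the code of a program from its components\<close>

lemma computes_Comp: "list_all2 (\<lambda>g y. computes g xs y) gs ys \<Longrightarrow> computes f ys z \<Longrightarrow> computes (Comp f gs) xs z"
  by (rule computes.intros)

lemma computes_Comp1: "computes g xs y \<Longrightarrow> computes f [y] z \<Longrightarrow> computes (Comp f [g]) xs z"
  by (rule computes_Comp[of _ _ "[y]"]) auto

lemma computes_Comp2:
  "computes g xs y \<Longrightarrow> computes h xs z \<Longrightarrow> computes f [y, z] v \<Longrightarrow> computes (Comp f [g, h]) xs v"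
  by (rule computes_Comp[of _ _ "[y, z]"]) auto

lemma computes_Proj: "i < length xs \<Longrightarrow> xs ! i = y \<Longrightarrow> computes (Proj i) xs y"
  using computes.intros(3) by blast

lemma computes_PrimRec:
  assumes "computes f xs (h 0)" "\<And>i. computes g (i # h i # xs) (h (Suc i))"
  shows "computes (PrimRec f g) (n # xs) (h n)"
  by (induction n) (auto intro: computes.intros assms)

primrec const_rec :: "nat \<Rightarrow> recf" where
  "const_rec 0 = Zero"
| "const_rec (Suc n) = Comp Succ [const_rec n]"

lemma computes_const: "computes (const_rec n) xs n"
  by (induction n) (auto intro: computes.intros computes_Comp1)

definition "add_rec = PrimRec (Proj 0) (Comp Succ [Proj 1])"

lemma computes_add: "computes add_rec [m, n] (m + n)"
proof -
  have "computes add_rec (m # [n]) ((\<lambda>m. m + n) m)"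
    unfolding add_rec_def
    by (rule computes_PrimRec) (auto intro!: computes_Proj computes_Comp1 computes.intros(2))
  then show ?thesis by simp
qed

definition "triangle_rec = PrimRec Zero (Comp add_rec [Comp Succ [Proj 0], Proj 1])"

lemma computes_triangle: "computes triangle_rec [n] (triangle n)"
proof -
  have "computes add_rec [Suc i, triangle i] (triangle (Suc i))" for i
    using computes_add[of "Suc i" "triangle i"] by (simp add: add.commute)
  moreover have "computes Zero [] (triangle 0)"
    by (metis computes.intros(1) triangle_0)
  ultimately show ?thesis
    unfolding triangle_rec_def
    by (intro computes_PrimRec) (auto intro!: computes_Comp2 computes_Comp1 computes.intros(2) computes_Proj)
qed

text \<open>The Cantor pairing \<open>triangle (m + n) + m\<close> behind
  \<open>prod_encode\<close>.\<close>

definition "pair_rec = Comp add_rec [Comp triangle_rec [add_rec], Proj 0]"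

lemma computes_pair: "computes pair_rec [m, n] (prod_encode (m, n))"
  unfolding pair_rec_def prod_encode_def
  by (auto intro!: computes_Comp2 computes_Comp1 computes_add computes_triangle computes_Proj)

text \<open>\<open>list_encode\<close> maps a nonempty list to the successor of the pair of its head
  and the code of its tail.\<close>

definition cons_rec :: "recf \<Rightarrow> recf \<Rightarrow> recf" where
  "cons_rec f g = Comp Succ [Comp pair_rec [f, g]]"

lemma computes_cons:
  "computes f xs y \<Longrightarrow> computes g xs (list_encode ys) \<Longrightarrow> computes (cons_rec f g) xs (list_encode (y # ys))"
  unfolding cons_rec_def list_encode.simps
  by (rule computes_Comp1[OF computes_Comp2[OF _ _ computes_pair]]) (auto intro: computes.intros(2))

primrec list_rec :: "recf list \<Rightarrow> recf" where
  "list_rec [] = Zero"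
| "list_rec (f # fs) = cons_rec f (list_rec fs)"

lemma computes_list:
  "list_all2 (\<lambda>f y. computes f xs y) fs ys \<Longrightarrow> computes (list_rec fs) xs (list_encode ys)"
  by (induction fs ys rule: list_all2_induct) (auto intro: computes_cons computes.intros(1) simp del: list_encode.simps(2))

text \<open>
  \<open>tasks as j\<close> lists initial tasks: counter \<open>i < j\<close>, whose handler is \<open>i + 3\<close>, has the value
  \<open>as ! i\<close>, and the handler 1 counts the sum of all counters.
\<close>

primrec tasks :: "nat list \<Rightarrow> nat \<Rightarrow> nat list" where
  "tasks as 0 = [0, 0, 2]"
| "tasks as (Suc j) = concat (replicate (as ! j) [j + 3, 1]) @ tasks as j"

text \<open>The primitive recursion runs over \<open>as ! j\<close>, starts from the code of the
  tail and puts \<open>j + 3\<close> and \<open>1\<close> in front in each round;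
  \<open>Proj 1\<close> is the code built so far.\<close>

primrec tasks_rec :: "nat \<Rightarrow> recf" where
  "tasks_rec 0 = list_rec (map const_rec [0, 0, 2])"
| "tasks_rec (Suc j) =
     Comp (PrimRec (Proj 0) (cons_rec (const_rec (j + 3)) (cons_rec (const_rec 1) (Proj 1))))
       [Proj j, tasks_rec j]"

lemma computes_tasks: "j \<le> length as \<Longrightarrow> computes (tasks_rec j) as (list_encode (tasks as j))"
proof (induction j)
  case 0
  have "list_all2 (\<lambda>f y. computes f as y) (map const_rec [0, 0, 2]) [0, 0, 2]"
    by (simp only: list.map list_all2_Cons list_all2_Nil computes_const simp_thms)
  then show ?case unfolding tasks_rec.simps tasks.simps by (rule computes_list)
next
  case (Suc j)
  let ?h = "\<lambda>n. list_encode (concat (replicate n [j + 3, 1]) @ tasks as j)"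
  let ?g = "cons_rec (const_rec (j + 3)) (cons_rec (const_rec 1) (Proj 1))"
  have "computes ?g (i # ?h i # [?h 0]) (?h (Suc i))" for i
    unfolding replicate_Suc concat.simps append_Cons append_Nil
    by (intro computes_cons computes_const computes_Proj) auto
  then have "computes (PrimRec (Proj 0) ?g) (n # [?h 0]) (?h n)" for n
    by (rule computes_PrimRec[rotated]) (auto intro: computes_Proj)
  moreover have "computes (tasks_rec j) as (?h 0)" using Suc by simp
  moreover have "computes (Proj j) as (as ! j)" using Suc.prems by (auto intro: computes_Proj)
  ultimately show ?case
    unfolding tasks_rec.simps tasks.simps by (intro computes_Comp2)
qed

text \<open>The self-reference: in \<open>undecidable_between\<close> the arguments are the first
  eight components of a program's code, and the component appended lists initial tasks that
  represent these very numbers.\<close>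

definition diag_rec :: "nat \<Rightarrow> recf" where
  "diag_rec k = list_rec (map Proj [0..<k] @ [tasks_rec k])"

lemma computes_diag: "computes (diag_rec (length as)) as (list_encode (as @ [list_encode (tasks as (length as))]))"
  unfolding diag_rec_def
  by (intro computes_list list_all2_appendI)
    (auto simp: list_all2_conv_all_nth intro: computes_Proj computes_tasks)

lemma count_tasks:
  "j \<le> length as \<Longrightarrow> count_list (tasks as j) b =
     (if b = 0 then 2 else if b = 1 then \<Sum>i<j. as ! i else if b = 2 then 1
      else if b < j + 3 then as ! (b - 3) else 0)"
proof (induction j)
  case (Suc j)
  have "count_list (concat (replicate n [j + 3, 1])) b = (if b = 1 \<or> b = j + 3 then n else 0)" for n
    by (induction n) auto
  with Suc show ?case by (cases "b = j + 3") auto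
qed auto

section \<open>Transitions of programs\<close>

text \<open>Reading a word letter by letter gives an operational view of \<open>step\<close>: what
  survives of \<open>b\<close> is decided by the last \<open>Cancel b\<close>.\<close>

fun effect :: "('s, 'i) letter \<Rightarrow> 's multiset \<Rightarrow> 's multiset" where
  "effect (Internal i) m = m"
| "effect (Post b) m = add_mset b m"
| "effect (Cancel b) m = filter_mset (\<lambda>x. x \<noteq> b) m"

lemma count_fold_effect:
  "Cancel b \<notin> set w \<Longrightarrow> count (fold effect w m) b = count m b + count_list w (Post b)"
proof (induction w arbitrary: m)
  case (Cons a w)
  then show ?case by (cases a) auto
qed simp

lemma count_fold_effect_Cancel:
  "Cancel b \<notin> set v \<Longrightarrow> count (fold effect (u @ [Cancel b] @ v) m) b = count_list v (Post b)"
  by (simp add: count_fold_effect)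

text \<open>The two clauses of \<open>step\<close> become one equation: either \<open>w\<close> is
  split at its last \<open>Cancel b\<close>, or there is none and the old tasks stay.\<close>

lemma effect_iff:
  assumes "w \<in> lists L"
  shows "((\<exists>u v. w = u @ [Cancel b] @ v \<and> v \<in> lists (L - {Cancel b}) \<and> k = count_list v (Post b)) \<or>
      (w \<in> lists (L - {Cancel b}) \<and> k = count m b + count_list w (Post b)))
    \<longleftrightarrow> k = count (fold effect w m) b"
    (is "?A \<or> ?B \<longleftrightarrow> ?C")
proof
  assume "?A \<or> ?B"
  then show ?C
  proof
    assume ?A
    then obtain u v where w: "w = u @ [Cancel b] @ v" "v \<in> lists (L - {Cancel b})"
      "k = count_list v (Post b)" by blast
    then have "Cancel b \<notin> set v" by auto
    from count_fold_effect_Cancel[OF this, of u m] w show ?C by simp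
  next
    assume ?B
    then have "Cancel b \<notin> set w" by auto
    with \<open>?B\<close> show ?C by (simp add: count_fold_effect)
  qed
next
  assume C: ?C
  show "?A \<or> ?B"
  proof (cases "Cancel b \<in> set w")
    case True
    then obtain u v where w: "w = u @ [Cancel b] @ v" "Cancel b \<notin> set v"
      by (metis append_Cons append_Nil split_list_last)
    moreover from w assms have "v \<in> lists (L - {Cancel b})" by auto
    moreover from C w have "k = count_list v (Post b)" by (simp add: count_fold_effect)
    ultimately show ?thesis by blast
  next
    case False
    with assms C show ?thesis by (auto simp: count_fold_effect in_lists_conv_set)
  qed
qed

lemma set_fold_effect:
  "w \<in> lists (Internal ` I \<union> Post ` H \<union> Cancel ` H') \<Longrightarrow> set_mset m \<subseteq> H \<Longrightarrow> set_mset (fold effect w m) \<subseteq> H"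
proof (induction w arbitrary: m)
  case (Cons a w)
  then have "set_mset (effect a m) \<subseteq> H" by (cases a) auto
  with Cons show ?case by simp
qed simp

text \<open>\<open>effect_iff\<close> fixes the counts of all handlers, so the new multiset is a
  function of the old one and the word.\<close>

lemma step_iff:
  assumes "is_apc \<PP>"
  shows "step \<PP> c \<sigma> c' \<longleftrightarrow> (\<exists>d m d' X w. c = (d, add_mset \<sigma> m) \<and> c' = (d', fold effect w m) \<and>
     d \<in> states \<PP> \<and> d' \<in> states \<PP> \<and> set_mset m \<subseteq> handlers \<PP> \<and> \<sigma> \<in> handlers \<PP> \<and>
     w \<in> lists (letters \<PP>) \<and> derives (moves \<PP>) [N d] (map T w @ [N d']) \<and>
     nonterm_of \<PP> \<sigma> = Some X \<and> derives (prods \<PP>) [N X] (map T w))"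
    (is "_ = ?R")
proof
  assume "step \<PP> c \<sigma> c'"
  then obtain d m d' m' X w where *: "c \<in> configs \<PP>" "c' \<in> configs \<PP>" "\<sigma> \<in> handlers \<PP>"
    "c = (d, m + {#\<sigma>#})" "c' = (d', m')" "w \<in> lists (letters \<PP>)"
    "derives (moves \<PP>) [N d] (map T w @ [N d'])"
    "nonterm_of \<PP> \<sigma> = Some X" "derives (prods \<PP>) [N X] (map T w)"
    "\<forall>b\<in>handlers \<PP>.
       (\<exists>u v. w = u @ [Cancel b] @ v \<and> v \<in> lists (letters \<PP> - {Cancel b}) \<and>
          count m' b = count_list v (Post b)) \<or>
       (w \<in> lists (letters \<PP> - {Cancel b}) \<and> count m' b = count m b + count_list w (Post b))"
    unfolding step_def by (elim conjE exE) (rule that, assumption+)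
  have eff: "count m' b = count (fold effect w m) b" if "b \<in> handlers \<PP>" for b
    using *(10) that unfolding effect_iff[OF *(6)] by blast
  have m: "set_mset m \<subseteq> handlers \<PP>" "set_mset m' \<subseteq> handlers \<PP>"
    using *(1,2,4,5) by (auto simp: configs_def)
  from *(6) m(1) have "set_mset (fold effect w m) \<subseteq> handlers \<PP>"
    unfolding letters_def by (rule set_fold_effect)
  \<comment> \<open>Outside the handlers both counts are zero.\<close>
  with m(2) eff have "count m' b = count (fold effect w m) b" for b
    by (metis count_inI subsetD)
  then have "m' = fold effect w m" by (rule multiset_eqI)
  with *(1-9) m(1) show ?R
    by (intro exI[of _ d] exI[of _ m] exI[of _ d'] exI[of _ X] exI[of _ w]) (auto simp: configs_def)
next
  assume ?R
  then obtain d m d' X w where *: "c = (d, add_mset \<sigma> m)" "c' = (d', fold effect w m)"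
     "d \<in> states \<PP>" "d' \<in> states \<PP>" "set_mset m \<subseteq> handlers \<PP>" "\<sigma> \<in> handlers \<PP>"
     "w \<in> lists (letters \<PP>)" "derives (moves \<PP>) [N d] (map T w @ [N d'])"
     "nonterm_of \<PP> \<sigma> = Some X" "derives (prods \<PP>) [N X] (map T w)"
    by blast
  from *(7,5) have "set_mset (fold effect w m) \<subseteq> handlers \<PP>"
    unfolding letters_def by (rule set_fold_effect)
  with * show "step \<PP> c \<sigma> c'"
    unfolding step_def
    by (intro conjI exI[of _ d] exI[of _ m] exI[of _ d'] exI[of _ "fold effect w m"] exI[of _ X]
        exI[of _ w] ballI iffD2[OF effect_iff[OF *(7)]] refl) (auto simp: configs_def)
qed

section \<open>Linear grammars as automata, and the grammar of the handlers\<close>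

primrec path :: "('d \<times> 'a \<times> 'd) set \<Rightarrow> 'd \<Rightarrow> 'a list \<Rightarrow> 'd \<Rightarrow> bool" where
  "path E d [] e \<longleftrightarrow> d = e"
| "path E d (a # w) e \<longleftrightarrow> (\<exists>d'. (d, a, d') \<in> E \<and> path E d' w e)"

lemma path_snoc: "path E d (w @ [a]) e \<longleftrightarrow> (\<exists>d'. path E d w d' \<and> (d', a, e) \<in> E)"
  by (induction w arbitrary: d) auto

definition linear :: "('d \<times> 'a \<times> 'd) set \<Rightarrow> ('d, 'a) grammar" where
  "linear E = (\<lambda>(d, a, e). (d, [T a, N e])) ` E"

text \<open>Each derivable form has exactly one nonterminal, at its right end, so a derivation
  spells out a path.\<close>

lemma derives_linear: "derives (linear E) [N d] (map T w @ [N e]) \<longleftrightarrow> path E d w e"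
proof
  have "\<exists>w e. u = map T w @ [N e] \<and> path E d w e" if "derives (linear E) [N d] u" for u
    using that
  proof (induction rule: rtranclp_induct)
    case base
    show ?case by (intro exI[of _ "[]"]) simp
  next
    case (step u v)
    then obtain w e where u: "u = map T w @ [N e]" "path E d w e" by blast
    from step(2) obtain x A y a e' where *: "(A, a, e') \<in> E" "u = x @ [N A] @ y" "v = x @ [T a, N e'] @ y"
      unfolding derives1_def linear_def by auto
    \<comment> \<open>The rewritten nonterminal must be the last symbol, as all symbols before the
      last are terminals.\<close>
    have "y = []"
    proof (rule ccontr)
      assume "y \<noteq> []"
      then obtain ys z where "y = ys @ [z]" by (cases y rule: rev_cases) auto
      with u(1) *(2) have "map T w = x @ [N A] @ ys" by simp
      then have "N A \<in> set (map T w)" by simp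
      then show False by auto
    qed
    with u(1) *(2) have "x = map T w" "A = e" by auto
    with u(2) * \<open>y = []\<close> show ?case
      by (intro exI[of _ "w @ [a]"] exI[of _ e']) (auto simp: path_snoc)
  qed
  moreover have "w = w' \<and> e = e'" if "map T w @ [N e] = map T w' @ [N e']" for w w' :: "'b list" and e e' :: 'a
    using that by (auto simp: inj_map_eq_map inj_def)
  ultimately show "derives (linear E) [N d] (map T w @ [N e]) \<Longrightarrow> path E d w e" by blast
next
  show "path E d w e \<Longrightarrow> derives (linear E) [N d] (map T w @ [N e])"
  proof (induction w arbitrary: e rule: rev_induct)
    case (snoc a w)
    then obtain d' where d': "path E d w d'" "(d', a, e) \<in> E" by (auto simp: path_snoc)
    from d'(2) have "(d', [T a, N e]) \<in> linear E" by (force simp: linear_def)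
    then have "derives1 (linear E) (map T w @ [N d']) (map T (w @ [a]) @ [N e])"
      unfolding derives1_def by (intro exI[of _ "map T w"] exI[of _ "[]"]) auto
    with snoc.IH[OF d'(1)] show ?case by (rule rtranclp.rtrancl_into_rtrancl)
  qed simp
qed

text \<open>
  Handler 0 derives all words without internal actions.  Every other handler \<open>\<sigma>\<close> only emits an
  internal action that lets the automaton see that \<open>\<sigma>\<close> has been dispatched.
\<close>

definition handler_prods :: "nat \<Rightarrow> (nat, (nat, nat) letter) grammar" where
  "handler_prods n = {(\<sigma>, [T (Internal \<sigma>)]) | \<sigma>. 0 < \<sigma> \<and> \<sigma> < n} \<union> {(0, [N 0, N 0]), (0, [])} \<union>
     {(0, [T a]) | a. a \<in> Post ` {..<n} \<union> Cancel ` {..<n}}"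

lemma derives_handler_pos:
  assumes "0 < \<sigma>" "\<sigma> < n"
  shows "derives (handler_prods n) [N \<sigma>] (map T w) \<longleftrightarrow> w = [Internal \<sigma>]"
proof
  have "u = [N \<sigma>] \<or> u = [T (Internal \<sigma>)]" if "derives (handler_prods n) [N \<sigma>] u" for u
    using that
  proof (induction rule: rtranclp_induct)
    case (step u v)
    then show ?case
      using assms(1) by (auto simp: derives1_def handler_prods_def append_eq_Cons_conv Cons_eq_append_conv)
  qed simp
  from this[of "map T w"] show "derives (handler_prods n) [N \<sigma>] (map T w) \<Longrightarrow> w = [Internal \<sigma>]"
    by (auto simp: map_eq_Cons_conv)
next
  have "(\<sigma>, [T (Internal \<sigma>)]) \<in> handler_prods n" using assms by (simp add: handler_prods_def)
  then have "derives1 (handler_prods n) [N \<sigma>] [T (Internal \<sigma>)]"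
    unfolding derives1_def by (intro exI[of _ "[]"]) auto
  then show "w = [Internal \<sigma>] \<Longrightarrow> derives (handler_prods n) [N \<sigma>] (map T w)" by simp
qed

lemma derives_handler_zero:
  "derives (handler_prods n) [N 0] (map T w) \<longleftrightarrow> w \<in> lists (Post ` {..<n} \<union> Cancel ` {..<n})"
proof
  have "set u \<subseteq> insert (N 0) (T ` (Post ` {..<n} \<union> Cancel ` {..<n}))"
    if "derives (handler_prods n) [N 0] u" for u
    using that
  proof (induction rule: rtranclp_induct)
    case (step u v)
    from step(2) obtain x A \<alpha> y where
      *: "(A, \<alpha>) \<in> handler_prods n" "u = x @ [N A] @ y" "v = x @ \<alpha> @ y" unfolding derives1_def by blast
    with step.IH have "A = 0" by auto
    with *(1) have "set \<alpha> \<subseteq> insert (N 0) (T ` (Post ` {..<n} \<union> Cancel ` {..<n}))"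
      by (auto simp: handler_prods_def)
    with * step.IH show ?case by auto
  qed simp
  from this[of "map T w"]
  show "derives (handler_prods n) [N 0] (map T w) \<Longrightarrow> w \<in> lists (Post ` {..<n} \<union> Cancel ` {..<n})"
    by auto
next
  \<comment> \<open>Generation from left to right: the trailing \<open>N 0\<close> is doubled and
    its first copy becomes the next letter.\<close>
  have gen: "derives (handler_prods n) [N 0] (map T w @ [N 0])"
    if "w \<in> lists (Post ` {..<n} \<union> Cancel ` {..<n})" for w
    using that
  proof (induction w rule: rev_induct)
    case (snoc a w)
    have "derives1 (handler_prods n) (map T w @ [N 0]) (map T w @ [N 0, N 0])"
      unfolding derives1_def
      by (rule exI[of _ "map T w"], rule exI[of _ 0], rule exI[of _ "[N 0, N 0]"], rule exI[of _ "[]"])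
        (simp add: handler_prods_def)
    moreover have "derives1 (handler_prods n) (map T w @ [N 0, N 0]) (map T w @ [T a, N 0])"
      unfolding derives1_def
      by (rule exI[of _ "map T w"], rule exI[of _ 0], rule exI[of _ "[T a]"], rule exI[of _ "[N 0]"])
        (use snoc.prems in \<open>simp add: handler_prods_def\<close>)
    moreover have "derives (handler_prods n) [N 0] (map T w @ [N 0])" using snoc by simp
    ultimately show ?case by (simp add: rtranclp.rtrancl_into_rtrancl)
  qed simp
  assume "w \<in> lists (Post ` {..<n} \<union> Cancel ` {..<n})"
  from gen[OF this] have "derives (handler_prods n) [N 0] (map T w @ [N 0])" .
  moreover have "derives1 (handler_prods n) (map T w @ [N 0]) (map T w)"
    unfolding derives1_def
    by (rule exI[of _ "map T w"], rule exI[of _ 0], rule exI[of _ "[]"], rule exI[of _ "[]"])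
      (simp add: handler_prods_def)
  ultimately show "derives (handler_prods n) [N 0] (map T w)"
    by (rule rtranclp.rtrancl_into_rtrancl)
qed

section \<open>Simulating counter machines\<close>

text \<open>
  Automaton state \<open>2 * l\<close> is address \<open>l\<close> of the machine and \<open>2 * l + 1\<close> lies in the middle of the
  instruction there; the last state \<open>2 * length cs + 1\<close> can only be entered after halting.
  Handler \<open>r + 3\<close> stands for the counter \<open>r\<close>, 1 for the sum of all counters, 2 for the permission to
  enter the last state and 0 for everything else.
\<close>

fun instr_edges :: "nat \<Rightarrow> instr \<Rightarrow> (nat \<times> (nat, nat) letter \<times> nat) set" where
  "instr_edges l (Inc r k) = {(2 * l, Post 1, 2 * l + 1), (2 * l + 1, Post (r + 3), 2 * k)}"
| "instr_edges l (Dec r k z) = {(2 * l, Internal (r + 3), 2 * l + 1), (2 * l + 1, Internal 1, 2 * k),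
     (2 * l, Cancel (r + 3), 2 * z)}"
| "instr_edges l (Jump k) = {(2 * l, Post 0, 2 * k)}"

text \<open>The loops labelled \<open>Post 0\<close> let handler 0 post itself again in any state,
  the last one included.\<close>

definition edges :: "instr list \<Rightarrow> (nat \<times> (nat, nat) letter \<times> nat) set" where
  "edges cs = (\<Union>l<length cs. instr_edges l (cs ! l)) \<union>
     {(2 * length cs, Internal 2, 2 * length cs + 1)} \<union>
     (\<lambda>d. (d, Post 0, d)) ` {..<2 * length cs + 2}"

definition program :: "instr list \<Rightarrow> nat \<Rightarrow> nat multiset \<Rightarrow> (nat, nat, nat, nat) apc" where
  "program cs M t = \<lparr>states = {..<2 * length cs + 2}, handlers = {..<M + 3}, internals = {..<M + 3},
     nonterms = {..<M + 3}, prods = handler_prods (M + 3),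
     nonterm_of = (\<lambda>\<sigma>. if \<sigma> < M + 3 then Some \<sigma> else None), moves = linear (edges cs),
     init_state = 0, init_tasks = t\<rparr>"

locale counter_machine =
  fixes cs :: "instr list" and M :: nat
  assumes wf: "I \<in> set cs \<Longrightarrow> instr_regs I \<subseteq> {..<M} \<and> targets I \<subseteq> {..length cs}"
begin

abbreviation "final \<equiv> Suc (2 * length cs)"

lemma edge_cases:
  assumes "(d, a, e) \<in> edges cs"
  obtains (Inc1) l r k where "l < length cs" "cs ! l = Inc r k" "r < M" "k \<le> length cs"
      "d = 2 * l" "a = Post 1" "e = Suc (2 * l)"
  | (Inc2) l r k where "l < length cs" "cs ! l = Inc r k" "r < M" "k \<le> length cs"
      "d = Suc (2 * l)" "a = Post (r + 3)" "e = 2 * k"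
  | (Dec1) l r k z where "l < length cs" "cs ! l = Dec r k z" "r < M" "k \<le> length cs" "z \<le> length cs"
      "d = 2 * l" "a = Internal (r + 3)" "e = Suc (2 * l)"
  | (Dec2) l r k z where "l < length cs" "cs ! l = Dec r k z" "r < M" "k \<le> length cs" "z \<le> length cs"
      "d = Suc (2 * l)" "a = Internal 1" "e = 2 * k"
  | (Zero) l r k z where "l < length cs" "cs ! l = Dec r k z" "r < M" "k \<le> length cs" "z \<le> length cs"
      "d = 2 * l" "a = Cancel (r + 3)" "e = 2 * z"
  | (Jump) l k where "l < length cs" "cs ! l = Jump k" "k \<le> length cs"
      "d = 2 * l" "a = Post 0" "e = 2 * k"
  | (Final) "d = 2 * length cs" "a = Internal 2" "e = final"
  | (Loop) "d < 2 * length cs + 2" "a = Post 0" "e = d"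
proof -
  from assms have "(\<exists>l<length cs. (d, a, e) \<in> instr_edges l (cs ! l)) \<or>
      d = 2 * length cs \<and> a = Internal 2 \<and> e = final \<or> d < 2 * length cs + 2 \<and> a = Post 0 \<and> e = d"
    unfolding edges_def by (simp add: image_iff Bex_def) blast
  then consider l where "l < length cs" "(d, a, e) \<in> instr_edges l (cs ! l)"
    | "d = 2 * length cs" "a = Internal 2" "e = final"
    | "d < 2 * length cs + 2" "a = Post 0" "e = d"
    by blast
  then show ?thesis
  proof cases
    case 1
    note l = 1
    from 1(1) have *: "instr_regs (cs ! l) \<subseteq> {..<M} \<and> targets (cs ! l) \<subseteq> {..length cs}"
      by (intro wf) simp
    show ?thesis
    proof (cases "cs ! l")
      case (Inc r k)
      with 1(2) consider "d = 2 * l" "a = Post 1" "e = Suc (2 * l)" | "d = Suc (2 * l)" "a = Post (r + 3)" "e = 2 * k"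
        by auto
      then show ?thesis
      proof cases
        case 1
        show ?thesis by (rule Inc1[of l r k]) (use 1 l(1) * Inc in auto)
      next
        case 2
        show ?thesis by (rule Inc2[of l r k]) (use 2 l(1) * Inc in auto)
      qed
    next
      case (Dec r k z)
      with 1(2) consider "d = 2 * l" "a = Internal (r + 3)" "e = Suc (2 * l)"
        | "d = Suc (2 * l)" "a = Internal 1" "e = 2 * k" | "d = 2 * l" "a = Cancel (r + 3)" "e = 2 * z"
        by auto
      then show ?thesis
      proof cases
        case 1
        show ?thesis by (rule Dec1[of l r k z]) (use 1 l(1) * Dec in auto)
      next
        case 2
        show ?thesis by (rule Dec2[of l r k z]) (use 2 l(1) * Dec in auto)
      next
        case 3
        show ?thesis by (rule Zero[of l r k z]) (use 3 l(1) * Dec in auto)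
      qed
    next
      case jump: (Jump k)
      show ?thesis by (rule Jump[of l k]) (use l * jump in auto)
    qed
  next
    case 2
    then show ?thesis by (rule Final)
  next
    case 3
    then show ?thesis by (rule Loop)
  qed
qed

lemma edges_bounded:
  assumes "(d, a, e) \<in> edges cs"
  shows "d < 2 * length cs + 2" "e < 2 * length cs + 2" "a \<in> letters (program cs M t)"
  using assms by (cases rule: edge_cases; simp add: letters_def program_def)+

lemma program_is_apc:
  assumes "set_mset t \<subseteq> {..<M + 3}"
  shows "is_apc (program cs M t)"
proof -
  let ?P = "program cs M t"
  have L: "letters ?P = Internal ` {..<M + 3} \<union> Post ` {..<M + 3} \<union> Cancel ` {..<M + 3}"
    by (simp add: letters_def program_def)
  have "prods ?P \<subseteq> nonterms ?P \<times>
       ({[N Y, N Z] | Y Z. Y \<in> nonterms ?P \<and> Z \<in> nonterms ?P} \<union> {[T a] | a. a \<in> letters ?P} \<union> {[]})"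
    unfolding L by (auto simp: program_def handler_prods_def)
  moreover have "moves ?P \<subseteq> states ?P \<times>
       ({[T a, N d] | a d. a \<in> letters ?P \<and> d \<in> states ?P} \<union> {[]})"
  proof
    fix p assume "p \<in> moves ?P"
    then obtain d a e where "(d, a, e) \<in> edges cs" "p = (d, [T a, N e])"
      by (auto simp: program_def linear_def)
    with edges_bounded[OF this(1)] show "p \<in> states ?P \<times>
       ({[T a, N d] | a d. a \<in> letters ?P \<and> d \<in> states ?P} \<union> {[]})"
      by (simp add: program_def)
  qed
  moreover have "dom (nonterm_of ?P) = handlers ?P" "ran (nonterm_of ?P) \<subseteq> nonterms ?P"
    by (auto simp: program_def dom_def ran_def split: if_splits)
  ultimately show ?thesis
    using assms unfolding is_apc_def by (simp add: program_def)
qed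

lemma path_bounded:
  assumes "path (edges cs) d w e" "d < 2 * length cs + 2"
  shows "e < 2 * length cs + 2 \<and> w \<in> lists (letters (program cs M t))"
  using assms
proof (induction w arbitrary: d)
  case (Cons a w)
  then obtain d' where d': "(d, a, d') \<in> edges cs" "path (edges cs) d' w e" by auto
  from Cons.IH[OF d'(2)] edges_bounded[OF d'(1)] show ?case by simp
qed simp

lemma step_program:
  assumes "set_mset t \<subseteq> {..<M + 3}"
  shows "step (program cs M t) c \<sigma> c' \<longleftrightarrow> (\<exists>d m e w. c = (d, add_mset \<sigma> m) \<and> c' = (e, fold effect w m) \<and>
     d < 2 * length cs + 2 \<and> set_mset m \<subseteq> {..<M + 3} \<and> \<sigma> < M + 3 \<and> path (edges cs) d w e \<and>
     (if \<sigma> = 0 then w \<in> lists (Post ` {..<M + 3} \<union> Cancel ` {..<M + 3}) else w = [Internal \<sigma>]))"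
    (is "?L = ?R")
proof
  assume ?L
  then obtain d m e X w where "c = (d, add_mset \<sigma> m)" "c' = (e, fold effect w m)"
     "d < 2 * length cs + 2" "set_mset m \<subseteq> {..<M + 3}" "\<sigma> < M + 3"
     "derives (linear (edges cs)) [N d] (map T w @ [N e])" "derives (handler_prods (M + 3)) [N \<sigma>] (map T w)"
    unfolding step_iff[OF program_is_apc[OF assms]] by (auto simp: program_def)
  then show ?R
    by (intro exI[of _ d] exI[of _ m] exI[of _ e] exI[of _ w])
      (auto simp: derives_linear derives_handler_zero derives_handler_pos)
next
  assume ?R
  then obtain d m e w where *: "c = (d, add_mset \<sigma> m)" "c' = (e, fold effect w m)"
     "d < 2 * length cs + 2" "set_mset m \<subseteq> {..<M + 3}" "\<sigma> < M + 3" "path (edges cs) d w e"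
     "if \<sigma> = 0 then w \<in> lists (Post ` {..<M + 3} \<union> Cancel ` {..<M + 3}) else w = [Internal \<sigma>]"
    by blast
  from path_bounded[OF *(6,3), of t] have "e < 2 * length cs + 2" "w \<in> lists (letters (program cs M t))"
    by auto
  moreover from *(6) have "derives (linear (edges cs)) [N d] (map T w @ [N e])"
    by (simp add: derives_linear)
  moreover have "derives (handler_prods (M + 3)) [N \<sigma>] (map T w)"
  proof (cases "\<sigma> = 0")
    case True
    with *(7) show ?thesis by (simp add: derives_handler_zero)
  next
    case False
    with *(5,7) show ?thesis by (intro iffD2[OF derives_handler_pos]) auto
  qed
  ultimately show ?L
    unfolding step_iff[OF program_is_apc[OF assms]] using *(1-5)
    by (intro exI[of _ d] exI[of _ m] exI[of _ e] exI[of _ \<sigma>] exI[of _ w]) (auto simp: program_def)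
qed

section \<open>An invariant of all runs\<close>

definition csum :: "nat multiset \<Rightarrow> nat" where
  "csum m = (\<Sum>r<M. count m (r + 3))"

lemma csum_split: "r < M \<Longrightarrow> csum m = count m (r + 3) + (\<Sum>q\<in>{..<M} - {r}. count m (q + 3))"
  unfolding csum_def by (subst sum.remove[of _ r]) auto

lemma csum_low [simp]: "b < 3 \<Longrightarrow> csum (add_mset b m) = csum m"
  unfolding csum_def by (intro sum.cong) auto

lemma csum_add [simp]: "r < M \<Longrightarrow> csum (add_mset (r + 3) m) = Suc (csum m)"
  by (simp add: csum_split[of r])

lemma csum_filter: "r < M \<Longrightarrow> csum m = csum (filter_mset (\<lambda>x. x \<noteq> r + 3) m) + count m (r + 3)"
  by (simp add: csum_split[of r])

text \<open>The lead of handler 1 in the middle of an instruction: an increment posts 1 before the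
  counter, and a decrement removes the counter before 1. The state \<open>final\<close> is odd too
  but belongs to no instruction.\<close>

definition mid :: "nat \<Rightarrow> nat" where
  "mid d = (if odd d \<and> d < final then 1 else 0)"

lemma mid_simps [simp]: "mid (2 * l) = 0" "mid final = 0" "l < length cs \<Longrightarrow> mid (Suc (2 * l)) = 1"
  by (auto simp: mid_def)

text \<open>
  A run that cancels a counter which is not zero is detected because the count of handler 1 then
  exceeds the sum of the counters for ever.
\<close>

definition honest :: "nat \<times> (nat \<Rightarrow> nat) \<Rightarrow> nat \<Rightarrow> nat multiset \<Rightarrow> bool" where
  "honest c0 d m \<longleftrightarrow> (\<exists>l s. creach cs c0 (l, s) \<and>
     (d = 2 * l \<and> (\<forall>q<M. count m (q + 3) = s q) \<or>
      d = Suc (2 * l) \<and> l < length cs \<and>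
      (case cs ! l of
         Inc r k \<Rightarrow> \<forall>q<M. count m (q + 3) = s q
       | Dec r k z \<Rightarrow> s r > 0 \<and> (\<forall>q<M. count m (q + 3) = (s(r := s r - 1)) q)
       | Jump k \<Rightarrow> False)))"

text \<open>The excess of \<open>count m 1\<close> over \<open>csum m + mid d\<close> grows with
  each false zero test and never shrinks; honesty is demanded while it is zero. The permission 2
  stays until \<open>final\<close>.\<close>

definition invariant :: "nat \<times> (nat \<Rightarrow> nat) \<Rightarrow> nat \<Rightarrow> nat multiset \<Rightarrow> bool" where
  "invariant c0 d m \<longleftrightarrow> (d \<noteq> final \<longrightarrow> 2 \<in># m) \<and>
     (count m 1 > csum m + mid d \<or> count m 1 = csum m + mid d \<and> honest c0 d m)"

lemma honest_cong:
  "(\<And>q. q < M \<Longrightarrow> count m (q + 3) = count m' (q + 3)) \<Longrightarrow> honest c0 d m \<Longrightarrow> honest c0 d m'"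
  unfolding honest_def by (elim ex_forward) (auto split: instr.splits)

lemma honest_even:
  assumes "honest c0 (2 * l) m"
  obtains s where "creach cs c0 (l, s)" "\<And>q. q < M \<Longrightarrow> count m (q + 3) = s q"
proof -
  from assms obtain l' s where s: "creach cs c0 (l', s)" "2 * l = 2 * l'" "\<forall>q<M. count m (q + 3) = s q"
    unfolding honest_def by (auto, presburger)
  then show ?thesis using that[of s] by simp
qed

lemma honest_odd:
  assumes "honest c0 (Suc (2 * l)) m"
  obtains s where "creach cs c0 (l, s)" "l < length cs"
    "case cs ! l of
         Inc r k \<Rightarrow> \<forall>q<M. count m (q + 3) = s q
       | Dec r k z \<Rightarrow> s r > 0 \<and> (\<forall>q<M. count m (q + 3) = (s(r := s r - 1)) q)
       | Jump k \<Rightarrow> False"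
proof -
  from assms obtain l' s where s: "creach cs c0 (l', s)" "Suc (2 * l) = Suc (2 * l')" "l' < length cs"
    "case cs ! l' of
         Inc r k \<Rightarrow> \<forall>q<M. count m (q + 3) = s q
       | Dec r k z \<Rightarrow> s r > 0 \<and> (\<forall>q<M. count m (q + 3) = (s(r := s r - 1)) q)
       | Jump k \<Rightarrow> False"
    unfolding honest_def by (auto, presburger)
  then show ?thesis using that[of s] by simp
qed

lemma honest_evenI:
  "creach cs c0 (l, s) \<Longrightarrow> (\<And>q. q < M \<Longrightarrow> count m (q + 3) = s q) \<Longrightarrow> honest c0 (2 * l) m"
  unfolding honest_def by blast

lemma creach_Suc: "creach cs c0 c \<Longrightarrow> cstep cs c = c' \<Longrightarrow> creach cs c0 c'"
  using creach_step creach_trans by blast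

text \<open>All moves but a false zero test keep the excess of handler 1, and then both alternatives
  of the invariant carry over once honesty does.\<close>

lemma inv_transfer:
  assumes "invariant c0 d m" "e = final \<or> 2 \<in># m'"
    "count m' 1 + csum m + mid d = count m 1 + csum m' + mid e" "honest c0 d m \<Longrightarrow> honest c0 e m'"
  shows "invariant c0 e m'"
  using assms unfolding invariant_def by auto

lemma inv_permit: "invariant c0 d m \<Longrightarrow> d \<noteq> final \<Longrightarrow> 2 \<in># m"
  by (simp add: invariant_def)

text \<open>These are the edges that are taken while handler 0 runs.\<close>

lemma inv_effect:
  assumes inv: "invariant c0 d m" and edge: "(d, a, e) \<in> edges cs" and a: "\<And>i. a \<noteq> Internal i"
  shows "invariant c0 e (effect a m)"
  using edge
proof (cases rule: edge_cases)
  case (Inc1 l r k)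
  have "honest c0 e (effect a m)" if "honest c0 d m"
  proof -
    from that Inc1 obtain s where s: "creach cs c0 (l, s)" "\<And>q. q < M \<Longrightarrow> count m (q + 3) = s q"
      by (auto elim: honest_even)
    with Inc1 show ?thesis unfolding honest_def
      by (intro exI[of _ l] exI[of _ s]) auto
  qed
  then show ?thesis by (intro inv_transfer[OF inv]) (use inv_permit[OF inv] Inc1 in simp_all)
next
  case (Inc2 l r k)
  have "honest c0 e (effect a m)" if "honest c0 d m"
  proof -
    from that Inc2 obtain s where s: "creach cs c0 (l, s)" "\<forall>q<M. count m (q + 3) = s q"
      by (auto elim: honest_odd)
    from s(1) have "creach cs c0 (k, s(r := Suc (s r)))"
      by (rule creach_Suc) (use Inc2 in simp)
    with s(2) Inc2 show ?thesis by (auto intro: honest_evenI)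
  qed
  then show ?thesis by (intro inv_transfer[OF inv]) (use inv_permit[OF inv] Inc2 in simp_all)
next
  case (Zero l r k z)
  have *: "csum m = csum (effect a m) + count m (r + 3)" using csum_filter[of r m] Zero by simp
  show ?thesis
  \<comment> \<open>Cancelling an empty counter is a correct zero test. Otherwise
    \<open>csum\<close> drops while handler 1 keeps its count, so the excess becomes
    positive.\<close>
  proof (cases "count m (r + 3) = 0")
    case True
    then have m: "effect a m = m" using Zero by (auto intro!: multiset_eqI)
    have "honest c0 e m" if "honest c0 d m"
    proof -
      from that Zero obtain s where s: "creach cs c0 (l, s)" "\<And>q. q < M \<Longrightarrow> count m (q + 3) = s q"
        by (auto elim: honest_even)
      from s(1) have "creach cs c0 (z, s)"
        by (rule creach_Suc) (use Zero s True in auto)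
      with s(2) Zero show ?thesis by (auto intro: honest_evenI)
    qed
    with inv Zero show ?thesis unfolding m invariant_def by auto
  next
    case False
    with inv Zero * show ?thesis unfolding invariant_def by auto
  qed
next
  case (Jump l k)
  have "honest c0 e (effect a m)" if "honest c0 d m"
  proof -
    from that Jump obtain s where s: "creach cs c0 (l, s)" "\<And>q. q < M \<Longrightarrow> count m (q + 3) = s q"
      by (auto elim: honest_even)
    from s(1) have "creach cs c0 (k, s)"
      by (rule creach_Suc) (use Jump in simp)
    with s(2) Jump show ?thesis by (auto intro: honest_evenI)
  qed
  then show ?thesis by (intro inv_transfer[OF inv]) (use inv_permit[OF inv] Jump in simp_all)
next
  case Loop
  have "honest c0 e (effect a m)" if "honest c0 d m"
    by (rule honest_cong[of m]) (use that Loop in auto)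
  then show ?thesis by (intro inv_transfer[OF inv]) (use inv_permit[OF inv] Loop in auto)
qed (use a in auto)

lemma inv_Internal:
  assumes no_halt: "\<And>c. creach cs c0 c \<Longrightarrow> fst c < length cs"
    and inv: "invariant c0 d (add_mset \<sigma> m)" and edge: "(d, Internal \<sigma>, e) \<in> edges cs"
  shows "invariant c0 e m"
  using edge
proof (cases rule: edge_cases)
  case (Dec1 l r k z)
  have "honest c0 e m" if "honest c0 d (add_mset \<sigma> m)"
  proof -
    from that Dec1 obtain s where s: "creach cs c0 (l, s)"
      "\<And>q. q < M \<Longrightarrow> count (add_mset \<sigma> m) (q + 3) = s q"
      by (auto elim: honest_even)
    have "s r > 0" "\<forall>q<M. count m (q + 3) = (s(r := s r - 1)) q"
      using s(2) Dec1 by (auto simp: s(2)[symmetric])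
    with s(1) Dec1 show ?thesis unfolding honest_def
      by (intro exI[of _ l] exI[of _ s]) auto
  qed
  then show ?thesis by (intro inv_transfer[OF inv]) (use inv_permit[OF inv] Dec1 in simp_all)
next
  case (Dec2 l r k z)
  have "honest c0 e m" if "honest c0 d (add_mset \<sigma> m)"
  proof -
    from that Dec2 obtain s where s: "creach cs c0 (l, s)" "s r > 0"
      "\<forall>q<M. count m (q + 3) = (s(r := s r - 1)) q"
      by (auto elim!: honest_odd)
    from s(1) have "creach cs c0 (k, s(r := s r - 1))"
      by (rule creach_Suc) (use Dec2 s(2) in simp)
    with s(3) Dec2 show ?thesis by (auto intro: honest_evenI)
  qed
  then show ?thesis by (intro inv_transfer[OF inv]) (use inv_permit[OF inv] Dec2 in simp_all)
next
  case Final
  \<comment> \<open>Honesty here would mean that the machine has halted, so \<open>final\<close> can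
    only be entered with a positive excess.\<close>
  have "\<not> honest c0 d (add_mset \<sigma> m)"
    using no_halt Final by (fastforce elim!: honest_even)
  then show ?thesis by (intro inv_transfer[OF inv]) (use Final in auto)
qed auto

lemma final_edge: "(final, a, e) \<in> edges cs \<Longrightarrow> a = Post 0 \<and> e = final"
  by (erule edge_cases) auto

lemma Internal2_edge: "(d, Internal 2, e) \<in> edges cs \<Longrightarrow> e = final"
  by (erule edge_cases) auto

lemma final_path: "path (edges cs) final w e \<Longrightarrow> e = final \<and> Internal \<sigma> \<notin> set w"
  by (induction w) (auto dest: final_edge)

text \<open>\<open>final\<close> would be the middle of an instruction at address
  \<open>length cs\<close>, where there is none.\<close>

lemma not_honest_final: "\<not> honest c0 final m"
  by (auto elim!: honest_odd)

lemma inv_path: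
  assumes "invariant c0 d m" "path (edges cs) d w e" "\<And>i. Internal i \<notin> set w"
  shows "invariant c0 e (fold effect w m)"
  using assms
proof (induction w arbitrary: d m)
  case (Cons a w)
  then obtain d' where d': "(d, a, d') \<in> edges cs" "path (edges cs) d' w e" by auto
  have "invariant c0 d' (effect a m)"
    by (rule inv_effect) (use Cons.prems d' in auto)
  with Cons.IH[of d' "effect a m"] d'(2) Cons.prems(3) show ?case by auto
qed simp

lemma inv_drop_zero: "invariant c0 d (add_mset 0 m) \<Longrightarrow> invariant c0 d m"
  using honest_cong[of "add_mset 0 m" m c0 d] unfolding invariant_def by auto

lemma inv_step:
  assumes no_halt: "\<And>c. creach cs c0 c \<Longrightarrow> fst c < length cs" and t: "set_mset t \<subseteq> {..<M + 3}"
    and "step (program cs M t) (d, m) \<sigma> (e, m')" "invariant c0 d m"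
  shows "invariant c0 e m'" "d = final \<Longrightarrow> e = final \<and> \<sigma> = 0" "\<sigma> = 2 \<Longrightarrow> e = final"
proof -
  from assms(3) obtain m1 w where *: "m = add_mset \<sigma> m1" "m' = fold effect w m1" "path (edges cs) d w e"
    "if \<sigma> = 0 then w \<in> lists (Post ` {..<M + 3} \<union> Cancel ` {..<M + 3}) else w = [Internal \<sigma>]"
    unfolding step_program[OF t] by auto
  show "invariant c0 e m'"
  proof (cases "\<sigma> = 0")
    case True
    with * assms(4) show ?thesis
      by (auto intro!: inv_path dest: inv_drop_zero)
  next
    case False
    with * assms(4) show ?thesis by (auto intro: inv_Internal[OF no_halt])
  qed
  show "d = final \<Longrightarrow> e = final \<and> \<sigma> = 0"
    using *(3,4) final_path[of w e \<sigma>] by (auto split: if_splits)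
  show "\<sigma> = 2 \<Longrightarrow> e = final" using *(3,4) by (auto dest: Internal2_edge)
qed

text \<open>If \<open>final\<close> is never entered, handler 2 stays pending and is never
  dispatched. Once \<open>final\<close> is entered, the same holds of handler 1, whose count stays
  above \<open>csum\<close>.\<close>

lemma no_fair_run:
  assumes no_halt: "\<And>c. creach cs (0, s0) c \<Longrightarrow> fst c < length cs" and t: "set_mset t \<subseteq> {..<M + 3}"
    and init: "invariant (0, s0) 0 t"
  shows "\<not> has_fair_infinite_run (program cs M t)"
proof
  assume "has_fair_infinite_run (program cs M t)"
  then obtain c s where run: "c 0 = (0, t)" "\<And>j. step (program cs M t) (c j) (s j) (c (Suc j))"
    and fair: "\<And>\<sigma>. \<sigma> < M + 3 \<Longrightarrow> finite {j. s j = \<sigma>} \<Longrightarrow> infinite {j. \<not> pending \<sigma> (c j)}"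
    unfolding has_fair_infinite_run_def fair_run_def infinite_run_def by (auto simp: program_def)
  have step: "step (program cs M t) (fst (c j), snd (c j)) (s j) (fst (c (Suc j)), snd (c (Suc j)))" for j
    using run(2)[of j] by simp
  have inv: "invariant (0, s0) (fst (c j)) (snd (c j))" for j
  proof (induction j)
    case (Suc j)
    from inv_step(1)[OF no_halt t step Suc] show ?case .
  qed (use init run(1) in simp)
  note stepD = inv_step(2,3)[OF no_halt t step inv]
  show False
  proof (cases "\<exists>J. fst (c J) = final")
    case False
    then have "2 \<in># snd (c j)" for j using inv[of j] by (auto simp: invariant_def)
    then have "{j. \<not> pending 2 (c j)} = {}" by (simp add: pending_def)
    moreover have "{j. s j = 2} = {}" using stepD(2) False by blast
    ultimately show False using fair[of 2] by simp
  next
    case True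
    then obtain J where J: "fst (c J) = final" by blast
    have fin: "fst (c j) = final" if "J \<le> j" for j
      using that by (induction rule: dec_induct) (use J stepD(1) in auto)
    have "count (snd (c j)) 1 > 0" if "J \<le> j" for j
    proof -
      \<comment> \<open>As honesty is impossible in \<open>final\<close>, the invariant leaves only
        its strict alternative.\<close>
      have "csum (snd (c j)) < count (snd (c j)) 1"
        using inv[of j] fin[OF that] by (simp add: invariant_def not_honest_final)
      then show ?thesis by linarith
    qed
    then have "j < J" if "\<not> pending 1 (c j)" for j
      using that unfolding pending_def by (meson not_le)
    then have "{j. \<not> pending 1 (c j)} \<subseteq> {..<J}" by auto
    moreover have "j < J" if "s j = 1" for j
      using that stepD(1)[of j] fin[of j] by (cases "j < J") auto
    then have "{j. s j = 1} \<subseteq> {..<J}" by auto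
    ultimately show False
      using fair[of 1] by (simp add: finite_subset[OF _ finite_lessThan])
  qed
qed

section \<open>Simulating a halting computation\<close>

definition represents :: "nat \<times> (nat \<Rightarrow> nat) \<Rightarrow> nat \<times> nat multiset \<Rightarrow> bool" where
  "represents c p \<longleftrightarrow> (case (c, p) of ((l, s), (d, m)) \<Rightarrow> d = 2 * l \<and> l \<le> length cs \<and>
     count m 0 = 2 \<and> count m 1 = csum m \<and> count m 2 = 1 \<and> (\<forall>r<M. count m (r + 3) = s r) \<and>
     set_mset m \<subseteq> {..<M + 3})"

lemma represents_inv: "represents (0, s) (0, t) \<Longrightarrow> invariant (0, s) 0 t"
  unfolding represents_def invariant_def honest_def
  by (auto simp: mid_def intro: creach_refl simp flip: count_greater_zero_iff)

abbreviation steps :: "nat multiset \<Rightarrow> nat \<times> nat multiset \<Rightarrow> nat \<times> nat multiset \<Rightarrow> bool" where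
  "steps t \<equiv> (\<lambda>p q. \<exists>\<sigma>. step (program cs M t) p \<sigma> q)\<^sup>*\<^sup>*"

lemma steps_step: "step (program cs M t) p \<sigma> q \<Longrightarrow> steps t p q"
  by (rule r_into_rtranclp) blast

lemma steps_zero:
  assumes t: "set_mset t \<subseteq> {..<M + 3}" and "path (edges cs) d w e"
    "w \<in> lists (Post ` {..<M + 3} \<union> Cancel ` {..<M + 3})" "d < 2 * length cs + 2"
    "set_mset m \<subseteq> {..<M + 3}"
  shows "steps t (d, add_mset 0 m) (e, fold effect w m)"
proof (rule steps_step)
  show "step (program cs M t) (d, add_mset 0 m) 0 (e, fold effect w m)"
    unfolding step_program[OF t]
    by (intro exI[of _ d] exI[of _ m] exI[of _ e] exI[of _ w]) (use assms in simp)
qed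

lemma step_pos:
  assumes t: "set_mset t \<subseteq> {..<M + 3}" and "(d, Internal \<sigma>, e) \<in> edges cs" "0 < \<sigma>" "\<sigma> < M + 3"
    "set_mset m \<subseteq> {..<M + 3}"
  shows "step (program cs M t) (d, add_mset \<sigma> m) \<sigma> (e, m)"
  unfolding step_program[OF t]
  by (intro exI[of _ d] exI[of _ m] exI[of _ e] exI[of _ "[Internal \<sigma>]"])
    (use assms edges_bounded[OF assms(2)] in simp)

lemma edgesI: "l < length cs \<Longrightarrow> x \<in> instr_edges l (cs ! l) \<Longrightarrow> x \<in> edges cs"
  unfolding edges_def by blast

lemma edges_loop: "d < 2 * length cs + 2 \<Longrightarrow> (d, Post 0, d) \<in> edges cs"
  unfolding edges_def by blast

text \<open>Increments, zero tests and jumps are one dispatch of handler 0, which posts itself again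
  to keep two copies. A decrement is a dispatch of the counter's handler followed by one of handler
  1.\<close>

lemma simulate_cstep:
  assumes t: "set_mset t \<subseteq> {..<M + 3}" and rep: "represents (l, s) (d, m)" and l: "l < length cs"
  shows "\<exists>q. steps t (d, m) q \<and> represents (cstep cs (l, s)) q"
proof -
  from l have wfl: "instr_regs (cs ! l) \<subseteq> {..<M} \<and> targets (cs ! l) \<subseteq> {..length cs}"
    by (intro wf) simp
  from rep have d: "d = 2 * l" and m: "count m 0 = 2" "count m 1 = csum m" "count m 2 = 1"
    "\<And>r. r < M \<Longrightarrow> count m (r + 3) = s r" "set_mset m \<subseteq> {..<M + 3}"
    by (auto simp: represents_def)
  from m(1) have "0 \<in># m" by (simp flip: count_greater_zero_iff)
  then obtain m0 where m0: "m = add_mset 0 m0" by (blast dest: multi_member_split)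
  have m0': "set_mset m0 \<subseteq> {..<M + 3}" using m(5) m0 by auto
  have l2: "d < 2 * length cs + 2" using l d by simp
  show ?thesis
  proof (cases "cs ! l")
    case (Inc r k)
    let ?w = "[Post 1, Post (r + 3), Post 0]"
    have e: "(2 * l, Post 1, Suc (2 * l)) \<in> edges cs" "(Suc (2 * l), Post (r + 3), 2 * k) \<in> edges cs"
      by (rule edgesI[OF l], simp add: Inc)+
    have "(2 * k, Post 0, 2 * k) \<in> edges cs" using Inc wfl by (intro edges_loop) simp
    with e have "path (edges cs) d ?w (2 * k)" by (auto simp: d)
    from steps_zero[OF t this _ l2 m0'] have "steps t (d, m) (2 * k, fold effect ?w m0)"
      using Inc wfl m0 by simp
    moreover have "represents (cstep cs (l, s)) (2 * k, fold effect ?w m0)"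
      using Inc wfl m l by (auto simp: represents_def m0)
    ultimately show ?thesis by blast
  next
    case (Dec r k z)
    have e: "(2 * l, Internal (r + 3), Suc (2 * l)) \<in> edges cs" "(Suc (2 * l), Internal 1, 2 * k) \<in> edges cs"
        "(2 * l, Cancel (r + 3), 2 * z) \<in> edges cs"
      by (rule edgesI[OF l], simp add: Dec)+
    show ?thesis
    proof (cases "s r = 0")
      case True
      let ?w = "[Cancel (r + 3), Post 0]"
      have "(2 * z, Post 0, 2 * z) \<in> edges cs" using Dec wfl by (intro edges_loop) simp
      with e have "path (edges cs) d ?w (2 * z)" by (auto simp: d)
      from steps_zero[OF t this _ l2 m0'] have st: "steps t (d, m) (2 * z, fold effect ?w m0)"
        using Dec wfl m0 by simp
      \<comment> \<open>A correct zero test cancels nothing.\<close>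
      have "count m0 (r + 3) = 0" using True m(4)[of r] Dec wfl m0 by simp
      then have "filter_mset (\<lambda>x. x \<noteq> r + 3) m0 = m0" by (auto intro!: multiset_eqI)
      then have "fold effect ?w m0 = m" by (simp add: m0)
      moreover have "represents (cstep cs (l, s)) (2 * z, m)"
        using Dec wfl m l True by (simp add: represents_def)
      ultimately show ?thesis using st by metis
    next
      case False
      have "r < M" using Dec wfl by simp
      with False m(4)[of r] have "r + 3 \<in># m" by (simp flip: count_greater_zero_iff)
      then obtain m1 where m1: "m = add_mset (r + 3) m1" by (blast dest: multi_member_split)
      \<comment> \<open>Handler 1 still counts the unit just removed, so it is pending.\<close>
      with m(2) \<open>r < M\<close> have "count m1 1 = Suc (csum m1)" by simp
      then have "1 \<in># m1" by (simp flip: count_greater_zero_iff)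
      then obtain m2 where m2: "m1 = add_mset 1 m2" by (blast dest: multi_member_split)
      have "steps t (d, m) (Suc (2 * l), m1)"
        unfolding m1 d by (rule steps_step[OF step_pos[OF t e(1)]]) (use \<open>r < M\<close> m(5) m1 in auto)
      moreover have "steps t (Suc (2 * l), m1) (2 * k, m2)"
        unfolding m2 by (rule steps_step[OF step_pos[OF t]]) (use e(2) m(5) m1 m2 in auto)
      ultimately have "steps t (d, m) (2 * k, m2)"
        by (rule rtranclp_trans)
      moreover have "represents (cstep cs (l, s)) (2 * k, m2)"
        using Dec wfl l False m(1-3,5) m(4)[symmetric] \<open>r < M\<close>
        by (auto simp: represents_def m1 m2)
      ultimately show ?thesis by blast
    qed
  next
    case (Jump k)
    have "path (edges cs) d [Post 0] (2 * k)" using edgesI[OF l] by (auto simp: Jump d)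
    from steps_zero[OF t this _ l2 m0'] have "steps t (d, m) (2 * k, m)"
      using m0 by simp
    moreover have "represents (cstep cs (l, s)) (2 * k, m)"
      using Jump wfl m l by (simp add: represents_def)
    ultimately show ?thesis by blast
  qed
qed

lemma simulate_creach:
  assumes t: "set_mset t \<subseteq> {..<M + 3}" and "represents c p" "creach cs c c'"
  shows "\<exists>q. steps t p q \<and> represents c' q"
proof -
  have "\<exists>q. steps t p q \<and> represents ((cstep cs ^^ n) c) q" for n
  proof (induction n)
    case 0
    from assms(2) show ?case by (intro exI[of _ p]) simp
  next
    case (Suc n)
    then obtain q where q: "steps t p q" "represents ((cstep cs ^^ n) c) q" by blast
    obtain l s d m where eq: "(cstep cs ^^ n) c = (l, s)" "q = (d, m)" by fastforce
    show ?case
    proof (cases "l < length cs")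
      case True
      from simulate_cstep[OF t q(2)[unfolded eq] True] obtain q' where
        "steps t q q'" "represents (cstep cs ((cstep cs ^^ n) c)) q'"
        unfolding eq by blast
      with q(1) show ?thesis by (intro exI[of _ q']) (simp del: cstep.simps)
    next
      case False
      with eq q show ?thesis by auto
    qed
  qed
  with assms(3) show ?thesis unfolding creach_def by blast
qed

text \<open>After halting, only two copies of 0 and the permission 2 are left. Dispatching 2 and
  then 0 for ever is fair, since no other handler is pending in \<open>final\<close>, and the second
  copy of 0 makes 0 a starved handler.\<close>

lemma starving_run:
  assumes rep: "represents (0, s0) (0, t)" and halts: "creach cs (0, s0) (length cs, s)"
    and zero: "\<And>r. r < M \<Longrightarrow> s r = 0"
  shows "has_fairly_starving_run (program cs M t)"
proof -
  let ?P = "program cs M t" and ?fin = "(final, {#0, 0#})"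
  from rep have t: "set_mset t \<subseteq> {..<M + 3}" by (simp add: represents_def)
  from simulate_creach[OF t rep halts] obtain m where st: "steps t (0, t) (2 * length cs, m)"
    and m: "represents (length cs, s) (2 * length cs, m)"
    by (auto simp: represents_def)
  have "csum m = 0" using m zero by (auto simp: represents_def csum_def)
  have "count m b = count {#0, 0, 2#} b" for b
  proof (cases "b < M + 3")
    case True
    then have "b = 0 \<or> b = 1 \<or> b = 2 \<or> b = (b - 3) + 3 \<and> b - 3 < M" by arith
    then consider "b = 0" | "b = 1" | "b = 2" | r where "b = r + 3" "r < M" by blast
    then show ?thesis
      using m zero \<open>csum m = 0\<close> by cases (auto simp: represents_def)
  next
    case False
    with m have "b \<notin># m" by (auto simp: represents_def)
    with False show ?thesis by (simp add: not_in_iff)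
  qed
  then have m: "m = add_mset 2 {#0, 0#}" by (intro multiset_eqI) (simp add: add_mset_commute)
  have "(2 * length cs, Internal 2, final) \<in> edges cs" by (simp add: edges_def)
  from step_pos[OF t this, of "{#0, 0#}"] have "step ?P (2 * length cs, m) 2 ?fin"
    by (simp add: m)
  from rtranclp_trans[OF st steps_step[OF this]] have run: "steps t (0, t) ?fin" .
  have loop: "step ?P ?fin 0 ?fin"
    unfolding step_program[OF t]
    by (intro exI[of _ final] exI[of _ "{#0#}"] exI[of _ "[Post 0]"])
      (simp add: edges_loop)
  \<comment> \<open>The induction puts steps in front of a run that stays in \<open>?fin\<close>, so
    the claim is proved for every configuration that leads there.\<close>
  have "\<exists>f g n. f 0 = (0, t) \<and> (\<forall>j. step ?P (f j) (g j) (f (Suc j))) \<and> (\<forall>j\<ge>n. f j = ?fin \<and> g j = 0)"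
    using run
  proof (induction rule: converse_rtranclp_induct)
    case base
    show ?case
      by (intro exI[of _ "\<lambda>_. ?fin"] exI[of _ "\<lambda>_. 0"]) (use loop in auto)
  next
    case (step p q)
    then obtain \<sigma> f g n where "step ?P p \<sigma> q" "f 0 = q" "\<And>j. step ?P (f j) (g j) (f (Suc j))"
      "\<And>j. j \<ge> n \<Longrightarrow> f j = ?fin \<and> g j = 0" by blast
    then show ?case
      by (intro exI[of _ "case_nat p f"] exI[of _ "case_nat \<sigma> g"] exI[of _ "Suc n"])
        (auto split: nat.splits)
  qed
  then obtain f g n where fg: "f 0 = (0, t)" "\<And>j. step ?P (f j) (g j) (f (Suc j))"
    "\<And>j. j \<ge> n \<Longrightarrow> f j = ?fin \<and> g j = 0" by blast
  have "infinite {j. \<not> pending \<sigma> (f j)}" if "finite {j. g j = \<sigma>}" for \<sigma>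
  proof (cases "\<sigma> = 0")
    case True
    have "{n..} \<subseteq> {j. g j = \<sigma>}" using fg(3) True by auto
    with that show ?thesis using infinite_Ici finite_subset by blast
  next
    case False
    have "{n..} \<subseteq> {j. \<not> pending \<sigma> (f j)}" using fg(3) False by (auto simp: pending_def)
    then show ?thesis using infinite_Ici finite_subset by blast
  qed
  with fg(1,2) have "fair_run ?P f g"
    unfolding fair_run_def infinite_run_def by (simp add: program_def)
  then have "fairly_starves ?P f g 0"
    unfolding fairly_starves_def using fg(3) by (intro conjI exI[of _ n]) auto
  then show ?thesis
    unfolding has_fairly_starving_run_def by (intro bexI[of _ 0]) (auto simp: program_def)
qed

end

section \<open>Diagonalisation\<close>

text \<open>The machine asks the alleged decision procedure about its own program. Answer 1 makes it
  loop, which rules out fair runs; answer 0 makes it halt with empty counters, which gives a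
  starving run. Either answer is wrong.\<close>

lemma undecidable_between:
  assumes starving: "\<And>\<PP>. has_fairly_starving_run \<PP> \<Longrightarrow> Q \<PP>"
    and fair: "\<And>\<PP>. Q \<PP> \<Longrightarrow> has_fair_infinite_run \<PP>"
  shows "\<not> decidable Q"
proof
  assume "decidable Q"
  then obtain f where f: "\<And>\<PP> n. is_apc \<PP> \<Longrightarrow> encodes n \<PP> \<Longrightarrow> computes f [n] (if Q \<PP> then 1 else 0)"
    unfolding decidable_def by blast
  \<comment> \<open>A code has eight components before the task list. Registers 0 to 7 hold them, 8
    receives the answer, and scratch space starts at 9.\<close>
  define D where "D = compile (Comp f [diag_rec 8]) [0..<8] 8 9"
  \<comment> \<open>The loop on register 8 runs for ever after answer 1 and is skipped after answer
    0; the argument registers are cleared behind it.\<close>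
  define C where "C = Seq D (Seq (While 8 (Incr 8)) (clears [0..<8]))"
  define cs where "cs = code 0 C (com_length C)"
  obtain M where M: "insert 8 (regs C) \<subseteq> {..<M}"
    using finite_nat_set_iff_bounded[of "insert 8 (regs C)"] finite_regs[of C] by blast
  have len: "length cs = com_length C" by (simp add: cs_def)
  interpret counter_machine cs M
  proof
    fix I assume "I \<in> set cs"
    then have "I \<in> set (code 0 C (com_length C))" by (simp add: cs_def)
    from regs_code[OF this] targets_code[OF this] M
    show "instr_regs I \<subseteq> {..<M} \<and> targets I \<subseteq> {..length cs}" by (auto simp: len)
  qed
  \<comment> \<open>No circularity arises: all components but the tasks depend only on
    \<open>cs\<close> and \<open>M\<close>, so they are fixed before the tasks are chosen.\<close>
  obtain as where as: "length as = 8"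
    and code: "\<And>ts. encodes (list_encode (as @ [list_encode ts])) (program cs M (mset ts))"
  proof -
    have "is_apc (program cs M {#})" by (rule program_is_apc) simp
    then obtain n where "encodes n (program cs M {#})" using encodes_exists by blast
    then obtain ds ss ks xs ps hs rs where *: "set ds = states (program cs M {#})"
      "set ss = handlers (program cs M {#})" "set ks = internals (program cs M {#})"
      "set xs = nonterms (program cs M {#})" "set ps = prods (program cs M {#})"
      "set hs = Map.graph (nonterm_of (program cs M {#}))" "set rs = moves (program cs M {#})"
      unfolding encodes_def by blast
    let ?as = "[list_encode ds, list_encode ss, list_encode ks, list_encode xs,
      prods_code ps, list_encode (map prod_encode hs), prods_code rs, 0]"
    have "encodes (list_encode (?as @ [list_encode ts])) (program cs M (mset ts))" for ts
      unfolding encodes_def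
      by (intro exI[of _ ds] exI[of _ ss] exI[of _ ks] exI[of _ xs] exI[of _ ps] exI[of _ hs]
          exI[of _ rs] exI[of _ ts]) (use * in \<open>simp add: program_def del: list_encode.simps\<close>)
    then show ?thesis by (intro that[of ?as]) simp_all
  qed
  define t where "t = mset (tasks as 8)"
  define \<PP> where "\<PP> = program cs M t"
  define s0 where "s0 r = (if r < 8 then as ! r else 0)" for r
  define y :: nat where "y = (if Q \<PP> then 1 else 0)"
  have M8: "8 < M" using M by simp
  have cnt: "count t b = (if b = 0 then 2 else if b = 1 then \<Sum>i<8. as ! i else if b = 2 then 1
      else if b < 8 + 3 then as ! (b - 3) else 0)" for b
    unfolding t_def count_mset using count_tasks[of 8 as b] as by simp
  have t: "set_mset t \<subseteq> {..<M + 3}"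
  proof
    fix b assume "b \<in># t"
    then have "count t b \<noteq> 0" by simp
    then show "b \<in> {..<M + 3}" using M8 by (simp add: cnt split: if_splits)
  qed
  have "csum t = (\<Sum>r<M. s0 r)"
    unfolding csum_def by (intro sum.cong) (auto simp: cnt s0_def)
  also have "\<dots> = (\<Sum>r<8. as ! r)"
    by (rule sum.mono_neutral_cong_right) (use M8 in \<open>auto simp: s0_def\<close>)
  finally have rep: "represents (0, s0) (0, t)"
    using t by (auto simp: represents_def cnt s0_def)
  \<comment> \<open>The argument is the code of \<open>\<PP>\<close> itself, so \<open>f\<close>
    answers \<open>y\<close> on it.\<close>
  have "computes f [list_encode (as @ [list_encode (tasks as 8)])] y"
    unfolding y_def \<PP>_def t_def by (intro f program_is_apc code) (use t in \<open>simp add: t_def\<close>)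
  then have "computes (Comp f [diag_rec 8]) as y"
    by (rule computes_Comp1[rotated]) (use computes_diag[of as] as in simp)
  moreover have "map s0 [0..<8] = as"
    by (rule nth_equalityI) (auto simp: as s0_def)
  ultimately have D: "exec D s0 (s0(8 := y))"
    unfolding D_def by (intro implementsD[OF implements_compile]) (auto simp: s0_def)
  have placed: "placed cs 0 (code 0 C (com_length C))"
    using placed_self[of "[]" cs] by (simp flip: cs_def)
  let ?i = "com_length D"
  \<comment> \<open>The exit address \<open>?i + 2\<close> lies just behind the two instructions of
    the loop.\<close>
  have pD: "placed cs 0 (code 0 D ?i)"
    and pL: "placed cs ?i (code ?i (While 8 (Incr 8)) (?i + 2))"
    using placed by (simp_all add: C_def placed_append)
  show False
  proof (cases "Q \<PP>")
    case True
    then have "creach cs (0, s0) (?i, s0(8 := 1))"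
      using creach_code[OF D pD] by (simp add: y_def)
    from diverges_code[OF this pL] have "fst c < length cs" if "creach cs (0, s0) c" for c
      using that by simp
    then have "\<not> has_fair_infinite_run \<PP>"
      unfolding \<PP>_def by (rule no_fair_run[OF _ t represents_inv[OF rep]])
    with fair True show False by blast
  next
    case False
    let ?s = "\<lambda>r. if r \<in> set [0..<8] then 0 else (s0(8 := y)) r"
    have "exec (Seq (While 8 (Incr 8)) (clears [0..<8])) (s0(8 := y)) ?s"
      by (rule exec.Seq[OF exec.While_zero exec_clears]) (use False in \<open>simp add: y_def\<close>)
    with D have "exec C s0 ?s" unfolding C_def by (rule exec.Seq)
    from creach_code[OF this placed] have "creach cs (0, s0) (length cs, ?s)" by (simp only: len)
    then have "has_fairly_starving_run \<PP>"
      unfolding \<PP>_def by (rule starving_run[OF rep]) (use False in \<open>auto simp: s0_def y_def\<close>)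
    with starving False show False by blast
  qed
qed

theorem theorem7p9:
  shows "\<not> decidable has_fair_infinite_run \<and> \<not> decidable has_fairly_starving_run"
proof
  have "has_fairly_starving_run \<PP> \<Longrightarrow> has_fair_infinite_run \<PP>" for \<PP> :: "(nat, nat, nat, nat) apc"
    unfolding has_fairly_starving_run_def has_fair_infinite_run_def fairly_starves_def by blast
  then show "\<not> decidable has_fair_infinite_run" "\<not> decidable has_fairly_starving_run"
    by (intro undecidable_between; blast)+
qed

end
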